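(* Let $r>0$ be fixed and, for each $n$, let $k=k_n=\lfloor rn\rfloor$. Let $(\mathbf{L}_n)_{n\ge 1}$ be a sequence of real symmetric positive definite matrices, $\mathbf{L}_n$ of size $n\times n$, such that $\operatorname{Tr}\left((\mathbf{L}_n+\mathbf{I})^{-2}\mathbf{L}_n\right)\to\infty$ as $n\to\infty$. Let $\mathcal{X}_n$ be the $k$-DPP with L-ensemble $\mathbf{L}_n$, and let $\tilde{\mathcal{X}}_n$ be the matched DPP, i.e. the DPP with L-ensemble $e^{\nu_n}\mathbf{L}_n$, where $\nu_n\in\mathbb{R}$ satisfies $$\sum_{i=1}^n \frac{\lambda_{i}e^{\nu_n}}{1+\lambda_{i}e^{\nu_n}}=k,$$ with $\lambda_1,\dots,\lambda_n$ the eigenvalues of $\mathbf{L}_n$. Let $m\ge 1$ be a fixed integer (with $m<k$, i.e. $n$ is taken large enough), and for $\alpha\subseteq\{1,\dots,n\}$ with $|\alpha|=m$ let $\pi_n(\alpha)=p(\alpha\subseteq\mathcal{X}_n)$ and $\tilde\pi_n(\alpha)=p(\alpha\subseteq\tilde{\mathcal{X}}_n)$. Then $$D_m(\pi_n,\tilde\pi_n)=O(n^{-1})\quad\text{as } n\to\infty .$$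
   Context: For a matrix $\mathbf{L}$ and a subset $\alpha$ of indices, $\mathbf{L}_\alpha$ is the principal submatrix with rows and columns indexed by $\alpha$ (the determinant of the empty matrix is 1). DPP: given an $n\times n$ positive definite matrix $\mathbf{L}$ (the L-ensemble), the DPP with L-ensemble $\mathbf{L}$ is the random subset $\mathcal{X}$ of $\{1,\dots,n\}$ with $p(\mathcal{X})=\det(\mathbf{L}_{\mathcal{X}})/\det(\mathbf{I}+\mathbf{L})$. $k$-DPP: the $k$-DPP with L-ensemble $\mathbf{L}$ is the random subset of $\{1,\dots,n\}$ of size exactly $k$ with probability mass function proportional to $\det(\mathbf{L}_{\mathcal{X}})$ on subsets with $|\mathcal{X}|=k$ and zero on other subsets (a DPP conditioned on $|\mathcal{X}|=k$). Normalised total variation distance between two order-$m$ inclusion measures $\pi,\tilde\pi$ (functions on the $m$-element subsets of $\{1,\dots,n\}$): $$D_m(\pi,\tilde\pi)=\binom{k}{m}^{-1}\sum_{\alpha\subseteq\{1,\dots,n\},\,|\alpha|=m}\left|\pi(\alpha)-\tilde\pi(\alpha)\right|.$$ *)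

theory Defs
  imports
    "HOL-Probability.Probability_Mass_Function"
    "HOL-Library.Landau_Symbols"
    "HOL-Computational_Algebra.Polynomial"
    "Jordan_Normal_Form.Determinant"
    "Jordan_Normal_Form.Char_Poly"
    "Jordan_Normal_Form.Gauss_Jordan_Elimination"
    "Jordan_Normal_Form.DL_Submatrix"
begin

text \<open>
  Row and column indices of matrices start at 0, so the ground set
  \<open>{1, ..., n}\<close> is rendered as \<open>{..<n}\<close>.
  \<open>Determinant.det\<close> is the determinant of matrices with explicit carriers; the name is
  qualified because the determinant on \<open>real ^ 'n ^ 'n\<close> is also in scope.
\<close>

definition sym_pos_def_mat :: "nat \<Rightarrow> real mat \<Rightarrow> bool" where
  "sym_pos_def_mat n A \<longleftrightarrow>
     A \<in> carrier_mat n n \<and> transpose_mat A = A \<and>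
     (\<forall>v \<in> carrier_vec n. v \<noteq> 0\<^sub>v n \<longrightarrow> scalar_prod v (A *\<^sub>v v) > 0)"

definition mat_trace :: "'a :: comm_monoid_add mat \<Rightarrow> 'a" where
  "mat_trace A = (\<Sum>i<dim_row A. A $$ (i, i))"

text \<open>Meaningful for invertible \<open>A\<close> only; unspecified otherwise.\<close>

definition inv_mat :: "'a :: field mat \<Rightarrow> 'a mat" where
  "inv_mat A = the (mat_inverse A)"

text \<open>
  The real eigenvalues with algebraic multiplicity; for a real symmetric matrix of size
  \<open>n\<close> these are all its \<open>n\<close> eigenvalues.
\<close>

definition eigvals :: "real mat \<Rightarrow> real multiset" where
  "eigvals A = proots (char_poly A)"

definition principal_minor :: "real mat \<Rightarrow> nat set \<Rightarrow> real" where
  "principal_minor L \<alpha> = Determinant.det (submatrix L \<alpha> \<alpha>)"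

text \<open>
  The laws of the random sets. \<open>embed_pmf f\<close> is the distribution with mass function \<open>f\<close>
  provided \<open>f\<close> is nonnegative with total mass 1. For \<open>dpp L\<close> this holds when \<open>L\<close> is positive
  definite, as the principal minors are then positive and add up to \<open>det (I + L)\<close>; for
  \<open>k_dpp k L\<close> one needs moreover that \<open>k\<close> is at most the size of \<open>L\<close>.
\<close>

definition dpp :: "real mat \<Rightarrow> nat set pmf" where
  "dpp L = embed_pmf (\<lambda>X.
     if X \<subseteq> {..<dim_row L}
     then principal_minor L X / Determinant.det (1\<^sub>m (dim_row L) + L)
     else 0)"

definition k_dpp :: "nat \<Rightarrow> real mat \<Rightarrow> nat set pmf" where
  "k_dpp k L = embed_pmf (\<lambda>X.
     if X \<subseteq> {..<dim_row L} \<and> card X = k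
     then principal_minor L X /
       (\<Sum>Y | Y \<subseteq> {..<dim_row L} \<and> card Y = k. principal_minor L Y)
     else 0)"

definition inclusion_prob :: "nat set pmf \<Rightarrow> nat set \<Rightarrow> real" where
  "inclusion_prob p \<alpha> = measure_pmf.prob p {X. \<alpha> \<subseteq> X}"

definition incl_dist ::
    "nat \<Rightarrow> nat \<Rightarrow> nat \<Rightarrow> (nat set \<Rightarrow> real) \<Rightarrow> (nat set \<Rightarrow> real) \<Rightarrow> real" where
  "incl_dist n k m \<pi> \<pi>' =
     (\<Sum>\<alpha> | \<alpha> \<subseteq> {..<n} \<and> card \<alpha> = m. \<bar>\<pi> \<alpha> - \<pi>' \<alpha>\<bar>) / real (k choose m)"

end

theory Submission
  imports Defs "Jordan_Normal_Form.Schur_Decomposition"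
begin

text \<open>
  Diagonalise \<open>L = U diag(\<lambda>) U\<^sup>T\<close>. Both random sets are mixtures of projection processes: choose a
  random set \<open>Y\<close> of eigenvectors, which for the DPP consists of independent Bernoulli choices with
  odds \<open>e\<^sup>\<nu> \<lambda>\<^sub>j\<close> and for the \<open>k\<close>-DPP follows the same law conditioned on \<open>|Y| = k\<close>. By the
  Cauchy-Binet formula the inclusion probability of \<open>\<alpha>\<close> is
  \<open>\<Sum>\<beta>. (det U\<^bsub>\<alpha>,\<beta>\<^esub>)\<^sup>2 P(\<beta> \<subseteq> Y)\<close>, and for fixed \<open>\<beta>\<close> the weights add up to 1 over \<open>\<alpha>\<close>, so it
  suffices to compare the two laws of \<open>Y\<close>.

  There the sum of \<open>|P(j \<in> Y | |Y| = k) - P(j \<in> Y)|\<close> over \<open>j\<close> is at most 4 whenever the mean of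
  \<open>|Y|\<close> is the integer \<open>k\<close>, however small the variance is: with \<open>a\<^sub>i = P(|Y| = i)\<close>, Stein's identity
  expresses both \<open>a\<^bsub>k+1\<^esub>\<close> and the tail sum \<open>\<Sum>t. t a\<^bsub>k+t\<^esub>\<close> by the quantities to be bounded. The first
  is used when \<open>a\<^bsub>k+1\<^esub> > a\<^sub>k / 2\<close>, in combination with log-concavity, and the second when
  \<open>a\<^bsub>k+1\<^esub> \<le> a\<^sub>k / 2\<close>, where the tail decays geometrically. Negative correlation extends the bound to
  sets of size \<open>m\<close> at the cost of a factor of order \<open>k\<^bsup>m-1\<^esup>\<close>, against \<open>k choose m\<close> of order \<open>k\<^sup>m\<close>.
\<close>

section \<open>Elementary symmetric functions and conditioned Bernoulli sets\<close>

text \<open>The degree is an integer so that the recursions below also hold at degree 0.\<close>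

definition esym :: "('a \<Rightarrow> real) \<Rightarrow> 'a set \<Rightarrow> int \<Rightarrow> real" where
  "esym x A i = (\<Sum>Y | Y \<subseteq> A \<and> int (card Y) = i. \<Prod>j\<in>Y. x j)"

text \<open>Remove \<open>\<beta>\<close> from each \<open>Y\<close>: the product splits and the
  size drops by \<open>card \<beta>\<close>. Divided by \<open>esym x A i\<close> this is the
  probability that the set conditioned to size \<open>i\<close> contains
  \<open>\<beta>\<close>.\<close>

lemma esym_containing:
  assumes "finite A" "\<beta> \<subseteq> A"
  shows "(\<Sum>Y | \<beta> \<subseteq> Y \<and> Y \<subseteq> A \<and> int (card Y) = i. \<Prod>j\<in>Y. x j) =
    (\<Prod>j\<in>\<beta>. x j) * esym x (A - \<beta>) (i - int (card \<beta>))"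
proof -
  have fin: "finite \<beta>" using assms finite_subset by blast
  have "(\<Sum>Y | \<beta> \<subseteq> Y \<and> Y \<subseteq> A \<and> int (card Y) = i. \<Prod>j\<in>Y. x j) =
    (\<Sum>Y | Y \<subseteq> A - \<beta> \<and> int (card Y) = i - int (card \<beta>). \<Prod>j\<in>\<beta> \<union> Y. x j)"
  proof (rule sum.reindex_bij_witness[of _ "\<lambda>Y. \<beta> \<union> Y" "\<lambda>Y. Y - \<beta>"])
    fix Y assume Y: "Y \<in> {Y. Y \<subseteq> A - \<beta> \<and> int (card Y) = i - int (card \<beta>)}"
    then have "finite Y" using assms(1) finite_subset by blast
    moreover have "\<beta> \<inter> Y = {}" using Y by auto
    ultimately have "card (\<beta> \<union> Y) = card \<beta> + card Y"
      using fin by (simp add: card_Un_disjoint)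
    then show "\<beta> \<union> Y \<in> {Y. \<beta> \<subseteq> Y \<and> Y \<subseteq> A \<and> int (card Y) = i}"
      using Y assms(2) by auto
    show "\<beta> \<union> Y - \<beta> = Y" using Y by auto
  next
    fix Y assume Y: "Y \<in> {Y. \<beta> \<subseteq> Y \<and> Y \<subseteq> A \<and> int (card Y) = i}"
    then have "finite Y" using assms(1) finite_subset by blast
    then have "card (Y - \<beta>) = card Y - card \<beta>" "card \<beta> \<le> card Y"
      using Y fin by (auto simp: card_Diff_subset card_mono)
    then show "Y - \<beta> \<in> {Y. Y \<subseteq> A - \<beta> \<and> int (card Y) = i - int (card \<beta>)}"
      using Y by auto
    show "\<beta> \<union> (Y - \<beta>) = Y" "(\<Prod>j\<in>\<beta> \<union> (Y - \<beta>). x j) = (\<Prod>j\<in>Y. x j)"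
      using Y by (auto intro: prod.cong)
  qed
  also have "\<dots> = (\<Sum>Y | Y \<subseteq> A - \<beta> \<and> int (card Y) = i - int (card \<beta>).
      (\<Prod>j\<in>\<beta>. x j) * (\<Prod>j\<in>Y. x j))"
  proof (rule sum.cong)
    fix Y assume Y: "Y \<in> {Y. Y \<subseteq> A - \<beta> \<and> int (card Y) = i - int (card \<beta>)}"
    then have "finite Y" using assms(1) finite_subset by blast
    moreover have "\<beta> \<inter> Y = {}" using Y by auto
    ultimately show "(\<Prod>j\<in>\<beta> \<union> Y. x j) = (\<Prod>j\<in>\<beta>. x j) * (\<Prod>j\<in>Y. x j)"
      using fin by (simp add: prod.union_disjoint)
  qed simp
  finally show ?thesis by (simp add: esym_def sum_distrib_left)
qed

text \<open>Split the subsets by membership of \<open>a\<close>. In terms of generating polynomials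
  this is multiplication by \<open>1 + x a * z\<close>.\<close>

lemma esym_remove:
  assumes "finite A" "a \<in> A"
  shows "esym x A i = esym x (A - {a}) i + x a * esym x (A - {a}) (i - 1)"
proof -
  have "{Y. Y \<subseteq> A \<and> int (card Y) = i} =
      {Y. Y \<subseteq> A - {a} \<and> int (card Y) = i} \<union> {Y. {a} \<subseteq> Y \<and> Y \<subseteq> A \<and> int (card Y) = i}"
    by auto
  moreover have "finite {Y. Y \<subseteq> A - {a} \<and> int (card Y) = i}"
    "finite {Y. {a} \<subseteq> Y \<and> Y \<subseteq> A \<and> int (card Y) = i}"
    using assms(1) by (auto intro: finite_subset[of _ "Pow A"])
  ultimately have "esym x A i = esym x (A - {a}) i +
      (\<Sum>Y | {a} \<subseteq> Y \<and> Y \<subseteq> A \<and> int (card Y) = i. \<Prod>j\<in>Y. x j)"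
    unfolding esym_def by (subst sum.union_disjoint[symmetric]) auto
  then show ?thesis
    using esym_containing[of A "{a}" x i] assms by simp
qed

lemma esym_eq_0: "i < 0 \<or> (finite A \<and> int (card A) < i) \<Longrightarrow> esym x A i = 0"
proof -
  assume "i < 0 \<or> (finite A \<and> int (card A) < i)"
  then have "int (card Y) \<noteq> i" if "Y \<subseteq> A" for Y
    using card_mono[of A Y] that by linarith
  then have none: "{Y. Y \<subseteq> A \<and> int (card Y) = i} = {}" by blast
  show ?thesis unfolding esym_def none by simp
qed

lemma esym_nonneg: "(\<And>j. j \<in> A \<Longrightarrow> 0 \<le> x j) \<Longrightarrow> 0 \<le> esym x A i"
  unfolding esym_def by (intro sum_nonneg prod_nonneg) auto

lemma esym_pos:
  assumes "finite A" "\<And>j. j \<in> A \<Longrightarrow> 0 < x j" "0 \<le> i" "i \<le> int (card A)"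
  shows "0 < esym x A i"
proof -
  obtain Y where "Y \<subseteq> A" "card Y = nat i"
    using obtain_subset_with_card_n[of "nat i" A] assms(4) by (metis nat_le_iff)
  then have "{Y. Y \<subseteq> A \<and> int (card Y) = i} \<noteq> {}" using assms(3) by auto
  moreover have "finite {Y. Y \<subseteq> A \<and> int (card Y) = i}"
    using assms(1) by (auto intro: finite_subset[of _ "Pow A"])
  ultimately show ?thesis
    unfolding esym_def using assms(2) by (intro sum_pos prod_pos) auto
qed

section \<open>Log-concavity, Stein's identity and the comparison of one-element inclusion
  probabilities\<close>

text \<open>Induction on \<open>A\<close>: the recursion turns both sides into polynomials in
  \<open>x a\<close>, compared coefficient by coefficient. All pairs \<open>i \<le> j\<close> are
  treated together because the middle coefficient needs the hypothesis at other gaps, and because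
  products make sense where \<open>esym\<close> vanishes and ratios do not.\<close>

lemma esym_log_concave:
  assumes "finite A" "\<And>j. j \<in> A \<Longrightarrow> 0 \<le> x j" "i \<le> j"
  shows "esym x A i * esym x A (j + 1) \<le> esym x A (i + 1) * esym x A j"
  using assms
proof (induction A arbitrary: i j rule: finite_induct)
  case empty
  then show ?case
    by (cases "j + 1 \<le> 0") (auto simp: esym_eq_0 intro!: mult_nonneg_nonneg esym_nonneg)
next
  case (insert a A)
  define E where "E = esym x A"
  have rec: "esym x (insert a A) i = E i + x a * E (i - 1)" for i
    using esym_remove[of "insert a A" a x i] insert.hyps by (simp add: E_def)
  have IH: "E i * E (j + 1) \<le> E (i + 1) * E j" if "i \<le> j" for i j
    unfolding E_def using insert.prems that by (intro insert.IH) auto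
  have xa: "0 \<le> x a" using insert.prems by auto
  have 1: "E i * E (j + 1) \<le> E (i + 1) * E j" by (rule IH[OF insert.prems(2)])
  have 2: "E (i - 1) * E j \<le> E i * E (j - 1)" using IH[of "i-1" "j-1"] insert.prems(2) by simp
  \<comment> \<open>The coefficient of \<open>x a\<close>. For \<open>i = j\<close> both sides
    agree; otherwise two instances of the hypothesis chain through \<open>E i * E j\<close>.\<close>
  have 3: "E (i - 1) * E (j + 1) + E i * E j \<le> E (i + 1) * E (j - 1) + E i * E j"
  proof (cases "i = j")
    case True then show ?thesis by (simp add: mult.commute)
  next
    case False
    then have "E (i - 1) * E (j + 1) \<le> E i * E j" using IH[of "i - 1" j] insert.prems(2) by simp
    also have "\<dots> \<le> E (i + 1) * E (j - 1)" using IH[of "i" "j - 1"] insert.prems(2) False by simp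
    finally show ?thesis by simp
  qed
  have "E i * E (j+1) + x a * (E (i - 1) * E (j + 1) + E i * E j) + x a * x a * (E (i - 1) * E j)
     \<le> E (i + 1) * E j + x a * (E (i + 1) * E (j - 1) + E i * E j) + x a * x a * (E i * E (j - 1))"
    by (rule add_mono[OF add_mono[OF 1 mult_left_mono[OF 3 xa]] mult_left_mono[OF 2]]) (use xa in simp)
  then show ?case unfolding rec by (simp add: algebra_simps)
qed

text \<open>Double counting of the pairs \<open>(Y, j)\<close> with \<open>j \<in> Y\<close>: each
  \<open>Y\<close> of size \<open>i\<close> occurs \<open>i\<close> times.\<close>

lemma esym_size_bias:
  assumes "finite A"
  shows "real_of_int i * esym x A i = (\<Sum>j\<in>A. x j * esym x (A - {j}) (i - 1))"
proof -
  have "real_of_int i * esym x A i =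
      (\<Sum>Y | Y \<subseteq> A \<and> int (card Y) = i. \<Sum>j\<in>A. if j \<in> Y then \<Prod>j\<in>Y. x j else 0)"
    unfolding esym_def sum_distrib_left
  proof (rule sum.cong)
    fix Y assume Y: "Y \<in> {Y. Y \<subseteq> A \<and> int (card Y) = i}"
    have "(\<Sum>j\<in>A. if j \<in> Y then \<Prod>j\<in>Y. x j else 0) = (\<Sum>j\<in>Y. \<Prod>j\<in>Y. x j)"
      using Y assms by (intro sum.mono_neutral_cong_right) auto
    then show "real_of_int i * (\<Prod>j\<in>Y. x j) = (\<Sum>j\<in>A. if j \<in> Y then \<Prod>j\<in>Y. x j else 0)"
      using Y by auto
  qed simp
  also have "\<dots> = (\<Sum>j\<in>A. \<Sum>Y | Y \<subseteq> A \<and> int (card Y) = i. if j \<in> Y then \<Prod>j\<in>Y. x j else 0)"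
    by (rule sum.swap)
  also have "\<dots> = (\<Sum>j\<in>A. \<Sum>Y | {j} \<subseteq> Y \<and> Y \<subseteq> A \<and> int (card Y) = i. \<Prod>j\<in>Y. x j)"
    using assms
    by (intro sum.cong sum.mono_neutral_cong_right) auto
  also have "\<dots> = (\<Sum>j\<in>A. x j * esym x (A - {j}) (i - 1))"
    using esym_containing[OF assms, of "{j}" x i for j] by (intro sum.cong) auto
  finally show ?thesis .
qed

text \<open>
  Up to the factor \<open>\<Prod>j\<in>A. 1 + x j\<close>, \<open>esym x A i\<close> is the probability that a sum of independent
  Bernoulli variables with odds \<open>x j\<close> equals \<open>i\<close>. In these terms the next lemma is Stein's identity
  for the test function \<open>indicator {i}\<close>.
\<close>

lemma esym_stein:
  assumes "finite A" "\<And>j. j \<in> A \<Longrightarrow> 0 < x j"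
  shows "(real_of_int i - (\<Sum>j\<in>A. x j / (1 + x j))) * esym x A i =
    (\<Sum>j\<in>A. x j / (1 + x j) * (esym x (A - {j}) (i - 1) - esym x (A - {j}) i))"
proof -
  have "(real_of_int i - (\<Sum>j\<in>A. x j / (1 + x j))) * esym x A i =
     (\<Sum>j\<in>A. x j * esym x (A - {j}) (i - 1) - x j / (1 + x j) * esym x A i)"
    using esym_size_bias[OF assms(1), of i x]
    by (simp add: left_diff_distrib sum_subtractf sum_distrib_right)
  also have "\<dots> = (\<Sum>j\<in>A. x j / (1 + x j) * (esym x (A - {j}) (i - 1) - esym x (A - {j}) i))"
  proof (rule sum.cong[OF refl])
    fix j assume j: "j \<in> A"
    define p b c where "p = x j / (1 + x j)" and "b = esym x (A - {j}) (i - 1)"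
      and "c = esym x (A - {j}) i"
    have "p * (1 + x j) = x j" unfolding p_def using assms(2)[OF j] by simp
    then have "x j = p + p * x j" by (simp add: distrib_left)
    then have "x j * b = p * b + p * x j * b" by (metis distrib_right)
    moreover have "p * (c + x j * b) = p * c + p * x j * b" by (simp add: distrib_left)
    ultimately have "x j * b - p * (c + x j * b) = p * (b - c)" by (simp add: right_diff_distrib)
    then show "x j * esym x (A - {j}) (i - 1) - x j / (1 + x j) * esym x A i =
       x j / (1 + x j) * (esym x (A - {j}) (i - 1) - esym x (A - {j}) i)"
      unfolding esym_remove[OF assms(1) j, of x i] p_def b_def c_def .
  qed
  finally show ?thesis .
qed

text \<open>If the sequence still rose from \<open>k\<close> to \<open>k + 1\<close>, log-concavity
  would make each \<open>esym x (A - {j})\<close> rise from \<open>k - 1\<close> to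
  \<open>k\<close>. Then the right-hand side of Stein's identity at \<open>k\<close> is negative,
  while the left-hand side is not, as the mean is at most \<open>k\<close>.\<close>

lemma esym_mode:
  assumes fin: "finite A" and pos: "\<And>j. j \<in> A \<Longrightarrow> 0 < x j"
    and k: "0 \<le> k" and mean: "(\<Sum>j\<in>A. x j / (1 + x j)) \<le> real_of_int k"
  shows "esym x A (k + 1) \<le> esym x A k"
proof (cases "int (card A) \<le> k")
  case True
  then show ?thesis using esym_eq_0[of "k + 1" A x] esym_nonneg[of A x k] pos fin
    by (simp add: less_imp_le)
next
  case False
  show ?thesis
  proof (rule ccontr)
    assume asm: "\<not> ?thesis"
    have lt: "esym x (A - {j}) (k - 1) < esym x (A - {j}) k" if j: "j \<in> A" for j
    proof (rule ccontr)
      define b where "b = esym x (A - {j})"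
      assume "\<not> ?thesis"
      then have le: "b k \<le> b (k - 1)" by (simp add: b_def)
      have fin': "finite (A - {j})" "card (A - {j}) = card A - 1" using fin j by auto
      have bk: "0 < b k" unfolding b_def using False fin' pos k by (intro esym_pos) auto
      have "b (k - 1) * b (k + 1) \<le> b k * b k"
        using esym_log_concave[of "A - {j}" x "k - 1" k] fin' pos by (simp add: b_def less_imp_le)
      also have "\<dots> \<le> b (k - 1) * b k" using le bk by simp
      finally have "b (k + 1) \<le> b k" using le bk by simp
      moreover have "x j * b k \<le> x j * b (k - 1)" using le pos[OF j] by simp
      ultimately have "esym x A (k + 1) \<le> esym x A k"
        unfolding esym_remove[OF fin j] b_def by simp
      with asm show False ..
    qed
    have ne: "A \<noteq> {}" using False k by auto
    have "(\<Sum>j\<in>A. x j / (1 + x j) * (esym x (A - {j}) (k - 1) - esym x (A - {j}) k)) < (\<Sum>j\<in>A. 0)"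
    proof (rule sum_strict_mono[OF fin ne])
      fix j assume "j \<in> A"
      then show "x j / (1 + x j) * (esym x (A - {j}) (k - 1) - esym x (A - {j}) k) < 0"
        using lt[of j] pos[of j] by (intro mult_pos_neg divide_pos_pos) auto
    qed
    moreover have "0 \<le> (real_of_int k - (\<Sum>j\<in>A. x j / (1 + x j))) * esym x A k"
      using mean pos by (intro mult_nonneg_nonneg esym_nonneg) (auto simp: less_imp_le)
    ultimately show False using esym_stein[OF fin, of x k] pos by simp
  qed
qed

lemma sum_half_powers: "(\<Sum>t=1..N. real t / 2 ^ t) \<le> 2"
proof -
  have "(\<Sum>t=1..N. real t / 2 ^ t) = 2 - (real N + 2) / 2 ^ N"
    by (induction N) (simp_all add: field_simps)
  then show ?thesis by simp
qed

text \<open>Each summand equals \<open>p j * \<bar>b j (k - 1) - b j k\<bar> / E k\<close>, an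
  absolute term of Stein's identity at \<open>k\<close>. The signed sum of these terms vanishes, so
  one-sided bounds suffice.\<close>

lemma esym_inclusion_l1:
  assumes fin: "finite A" and pos: "\<And>j. j \<in> A \<Longrightarrow> 0 < x j"
    and k: "1 \<le> k" and mean: "(\<Sum>j\<in>A. x j / (1 + x j)) = real_of_int k"
  shows "(\<Sum>j\<in>A. \<bar>x j * esym x (A - {j}) (k - 1) / esym x A k - x j / (1 + x j)\<bar>) \<le> 4"
proof -
  define E where "E = esym x A"
  define b where "b = (\<lambda>j. esym x (A - {j}))"
  define p where "p = (\<lambda>j. x j / (1 + x j))"
  have p: "0 < p j" "p j < 1" if "j \<in> A" for j
    unfolding p_def using pos[OF that] by (auto simp: field_simps)
  have ne: "A \<noteq> {}" using mean k by auto
  have "(\<Sum>j\<in>A. p j) < (\<Sum>j\<in>A. 1)" using p by (intro sum_strict_mono fin ne) auto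
  \<comment> \<open>Strictness matters: \<open>b j k\<close> lives on one element fewer than
    \<open>A\<close> and must still be positive.\<close>
  then have k_card: "k < int (card A)" using mean by (simp add: p_def)
  have Ek: "0 < E k" unfolding E_def using k k_card by (intro esym_pos fin pos) auto
  have fin': "finite (A - {j})" for j using fin by simp
  have pos': "0 < x i" "0 \<le> x i" if "i \<in> A - {j}" for i j using pos[of i] that by auto
  have b_pos: "0 < b j k" if "j \<in> A" for j
    unfolding b_def using k k_card that fin by (intro esym_pos pos') auto
  have b_nonneg: "0 \<le> b j i" for j i unfolding b_def by (intro esym_nonneg pos')
  have E_rec: "E i = b j i + x j * b j (i - 1)" if "j \<in> A" for i j
    unfolding E_def b_def by (rule esym_remove[OF fin that])
  have stein: "(real_of_int i - real_of_int k) * E i = (\<Sum>j\<in>A. p j * (b j (i - 1) - b j i))" for i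
    using esym_stein[OF fin, of x i] pos mean by (simp add: E_def b_def p_def)
  \<comment> \<open>This is where the mean being exactly the integer \<open>k\<close> enters:
    positive and negative parts have equal total.\<close>
  have zero: "(\<Sum>j\<in>A. p j * (b j (k - 1) - b j k)) = 0" using stein[of k] by simp
  have lc: "b j (k - 1) * b j (k + 1) \<le> b j k * b j k" for j
    using esym_log_concave[OF fin'[of j] pos'(2)[of _ j], where i="k - 1" and j=k] by (simp add: b_def)
  have mode: "E (k + 1) \<le> E k"
    unfolding E_def using k mean by (intro esym_mode fin pos) auto
  \<comment> \<open>Deleting \<open>j\<close> only lowers the mean, so the one-sided hypothesis of
    \<open>esym_mode\<close> still holds.\<close>
  have b_mode: "b j (k + 1) \<le> b j k" if "j \<in> A" for j
    unfolding b_def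
  proof (rule esym_mode[OF fin' pos'(1)])
    have "(\<Sum>j\<in>A. p j) = p j + (\<Sum>j\<in>A - {j}. p j)" using fin that by (simp add: sum.remove)
    then show "(\<Sum>j\<in>A - {j}. x j / (1 + x j)) \<le> real_of_int k"
      using mean p[OF that] by (simp add: p_def)
  qed (use k in auto)
  have bound: "(\<Sum>j\<in>A. p j * \<bar>b j (k - 1) - b j k\<bar>) \<le> 4 * E k"
  proof (cases "2 * E (k + 1) \<le> E k")
    case True
    \<comment> \<open>By log-concavity successive ratios do not increase, so a first ratio of at
      most 1/2 persists.\<close>
    have decay: "E (k + int t) \<le> E k / 2 ^ t" for t
    proof (induction t)
      case (Suc t)
      have "E k * E (k + int (Suc t)) \<le> E (k + 1) * E (k + int t)"
        using esym_log_concave[OF fin, of x k "k + int t"] pos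
        by (simp add: E_def less_imp_le add.assoc add.commute[of 1])
      also have "\<dots> \<le> (E k / 2) * (E k / 2 ^ t)"
        using Suc True Ek unfolding E_def
        by (intro mult_mono esym_nonneg) (auto simp: less_imp_le pos)
      finally have "E k * E (k + int (Suc t)) \<le> E k * (E k / 2 ^ Suc t)" by (simp add: field_simps)
      then show ?case by (rule mult_left_le_imp_le[OF _ Ek])
    qed simp
    \<comment> \<open>Stein's identity at \<open>k + t\<close> has the factor \<open>t\<close> on
      the left; summed over \<open>t\<close>, the right-hand sides telescope. For
      \<open>N = card A\<close> the last term vanishes for reasons of degree.\<close>
    have "(\<Sum>t=1..N. real t * E (k + int t)) = (\<Sum>j\<in>A. p j * (b j k - b j (k + int N)))" for N
    proof (induction N)
      case (Suc N)
      have "real (Suc N) * E (k + int (Suc N)) =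
          (\<Sum>j\<in>A. p j * (b j (k + int N) - b j (k + int (Suc N))))"
        using stein[of "k + int (Suc N)"] by (simp add: add.assoc)
      with Suc show ?case by (simp add: sum.distrib[symmetric] algebra_simps)
    qed simp
    from this[of "card A"] have "(\<Sum>j\<in>A. p j * b j k) = (\<Sum>t=1..card A. real t * E (k + int t))"
    proof -
      have "b j (k + int (card A)) = 0" if "j \<in> A" for j
        unfolding b_def using fin k that card_gt_0_iff[of A] by (intro esym_eq_0) auto
      then show ?thesis
        using \<open>(\<Sum>t=1..card A. real t * E (k + int t)) = _\<close> by simp
    qed
    also have "\<dots> \<le> (\<Sum>t=1..card A. real t * (E k / 2 ^ t))"
      using decay by (intro sum_mono mult_left_mono) auto
    also have "\<dots> = E k * (\<Sum>t=1..card A. real t / 2 ^ t)" by (simp add: sum_distrib_left mult_ac)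
    also have "\<dots> \<le> E k * 2" using sum_half_powers Ek by (intro mult_left_mono) auto
    finally have half: "(\<Sum>j\<in>A. p j * b j k) \<le> 2 * E k" by simp
    \<comment> \<open>By \<open>zero\<close> the two parts have equal sums, so the triangle
      inequality costs a factor 2; with the bound \<open>2 * E k\<close> on one part this gives
      4.\<close>
    have "(\<Sum>j\<in>A. p j * \<bar>b j (k - 1) - b j k\<bar>) \<le> (\<Sum>j\<in>A. p j * (b j (k - 1) + b j k))"
      using p b_nonneg by (intro sum_mono mult_left_mono) (auto simp: less_imp_le abs_le_iff)
    also have "\<dots> = 2 * (\<Sum>j\<in>A. p j * b j k)"
      using zero by (simp add: algebra_simps sum.distrib sum_subtractf)
    finally show ?thesis using half by simp
  next
    case False
    \<comment> \<open>For \<open>d = b j (k - 1) - b j k\<close>, \<open>\<bar>d\<bar>\<close> is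
      twice the positive part of \<open>d\<close> minus \<open>d\<close>, and the positive part is
      at most \<open>2 * (b j k - b j (k + 1))\<close>; hence the 4. Stein's identity at
      \<open>k + 1\<close> and at \<open>k\<close> then evaluates the sum over
      \<open>j\<close>.\<close>
    have "\<bar>b j (k - 1) - b j k\<bar> \<le> 4 * (b j k - b j (k + 1)) - (b j (k - 1) - b j k)" if j: "j \<in> A" for j
    proof (cases "b j (k - 1) \<le> b j k")
      case True then show ?thesis using b_mode[OF j] by simp
    next
      case gt: False
      \<comment> \<open>Log-concavity on \<open>A - {j}\<close> bounds this by
        \<open>b j k * E k\<close>, and \<open>E k < 2 * E (k + 1)\<close> in this case, so
        \<open>b j (k - 1)\<close> is at most twice \<open>b j k\<close>.\<close>
      have "E (k + 1) * b j (k - 1) = b j (k - 1) * b j (k + 1) + b j k * (x j * b j (k - 1))"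
        using E_rec[OF j, of "k + 1"] by (simp add: algebra_simps)
      also have "\<dots> \<le> b j k * E k"
        using lc[of j] E_rec[OF j, of k] by (simp add: algebra_simps)
      also have "\<dots> \<le> b j k * (2 * E (k + 1))" using False b_pos[OF j] by (intro mult_left_mono) auto
      finally have "E (k + 1) * b j (k - 1) \<le> E (k + 1) * (2 * b j k)" by (simp add: mult_ac)
      moreover have "0 < E (k + 1)" using False Ek by simp
      ultimately have ratio: "b j (k - 1) \<le> 2 * b j k" by simp
      have "b j k * (b j (k - 1) - b j k) \<le> b j (k - 1) * (b j k - b j (k + 1))"
        using lc[of j] by (simp add: algebra_simps)
      also have "\<dots> \<le> (2 * b j k) * (b j k - b j (k + 1))"
        using ratio b_mode[OF j] by (intro mult_right_mono) auto
      finally have "b j k * (b j (k - 1) - b j k) \<le> b j k * (2 * (b j k - b j (k + 1)))"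
        by (simp only: mult_ac)
      then have "b j (k - 1) - b j k \<le> 2 * (b j k - b j (k + 1))" using b_pos[OF j] by simp
      then show ?thesis using gt by simp
    qed
    then have "(\<Sum>j\<in>A. p j * \<bar>b j (k - 1) - b j k\<bar>) \<le>
        (\<Sum>j\<in>A. p j * (4 * (b j k - b j (k + 1)) - (b j (k - 1) - b j k)))"
      using p by (intro sum_mono mult_left_mono) (auto simp: less_imp_le)
    also have "\<dots> = 4 * (\<Sum>j\<in>A. p j * (b j k - b j (k + 1))) - (\<Sum>j\<in>A. p j * (b j (k - 1) - b j k))"
      unfolding sum_distrib_left sum_subtractf[symmetric] by (intro sum.cong refl) (simp add: algebra_simps)
    also have "\<dots> = 4 * E (k + 1)" using stein[of "k + 1"] zero by simp
    finally show ?thesis using mode by simp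
  qed
  have "(\<Sum>j\<in>A. \<bar>x j * b j (k - 1) / E k - p j\<bar>) = (\<Sum>j\<in>A. p j * \<bar>b j (k - 1) - b j k\<bar>) / E k"
    unfolding sum_divide_distrib
  proof (rule sum.cong[OF refl])
    fix j assume j: "j \<in> A"
    have "p j * (1 + x j) = x j" unfolding p_def using pos[OF j] by simp
    then have xp: "x j = p j + p j * x j" by (simp add: distrib_left)
    have "x j * b j (k - 1) - p j * E k = (p j + p j * x j) * b j (k - 1) - p j * E k"
      using xp by simp
    also have "\<dots> = p j * (b j (k - 1) - b j k)"
      unfolding E_rec[OF j, of k] by (simp add: algebra_simps)
    finally have "(x j * b j (k - 1) - p j * E k) / E k = p j * (b j (k - 1) - b j k) / E k"
      by (rule arg_cong)
    then have "x j * b j (k - 1) / E k - p j = p j * (b j (k - 1) - b j k) / E k"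
      using Ek by (simp add: diff_divide_distrib)
    then show "\<bar>x j * b j (k - 1) / E k - p j\<bar> = p j * \<bar>b j (k - 1) - b j k\<bar> / E k"
      using Ek p(1)[OF j] by (simp add: abs_mult)
  qed
  also have "\<dots> \<le> 4" using bound Ek by (simp add: divide_le_eq)
  finally show ?thesis unfolding E_def b_def p_def .
qed

section \<open>Inclusion probabilities of a Bernoulli set conditioned on its size\<close>

text \<open>\<open>P(\<beta> \<subseteq> Y | |Y| = k)\<close> for a random subset \<open>Y\<close> of \<open>A\<close> made of independent choices with odds \<open>x\<close>.\<close>

definition cond_incl :: "('a \<Rightarrow> real) \<Rightarrow> 'a set \<Rightarrow> int \<Rightarrow> 'a set \<Rightarrow> real" where
  "cond_incl x A k \<beta> = (\<Prod>j\<in>\<beta>. x j) * esym x (A - \<beta>) (k - int (card \<beta>)) / esym x A k"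

lemma cond_incl_nonneg:
  assumes "\<And>j. j \<in> A \<Longrightarrow> 0 \<le> x j" "\<beta> \<subseteq> A"
  shows "0 \<le> cond_incl x A k \<beta>"
  unfolding cond_incl_def using assms by (intro divide_nonneg_nonneg mult_nonneg_nonneg prod_nonneg esym_nonneg) auto

text \<open>Induction on \<open>\<beta>\<close> after clearing denominators: each newly included
  \<open>i\<close> is handled by the pairwise negative correlation of \<open>i\<close> and
  \<open>j\<close> on the remaining set, which is log-concavity.\<close>

lemma cond_incl_neg_corr:
  assumes fin: "finite A" and pos: "\<And>j. j \<in> A \<Longrightarrow> 0 < x j" and kA: "k \<le> int (card A)"
    and j: "j \<in> A" and \<beta>: "\<beta> \<subseteq> A - {j}" and le: "int (card \<beta>) \<le> k"
  shows "cond_incl x A k (insert j \<beta>) \<le> cond_incl x A k \<beta> * cond_incl x A k {j}"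
proof -
  have fin_\<beta>: "finite \<beta>" using fin \<beta> by (meson finite_Diff finite_subset)
  have key: "esym x (A - \<beta> - {j}) (k - int (card \<beta>) - 1) * esym x A k
      \<le> esym x (A - \<beta>) (k - int (card \<beta>)) * esym x (A - {j}) (k - 1)"
    using fin_\<beta> \<beta> le
  proof (induction \<beta> rule: finite_induct)
    case (insert i \<beta>)
    define B l where "B = A - \<beta>" and "l = k - int (card \<beta>)"
    define E where "E = esym x (B - {i} - {j})"
    have i: "i \<in> B" "i \<noteq> j" "j \<in> B" and finB: "finite B"
      using insert.hyps insert.prems fin j by (auto simp: B_def)
    have xi: "0 < x i" "0 < x j" using i pos unfolding B_def by auto
    have IH: "esym x (B - {j}) (l - 1) * esym x A k \<le> esym x B l * esym x (A - {j}) (k - 1)"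
      using insert unfolding B_def l_def by auto
    have "esym x (B - {j}) (l - 1) = E (l - 1) + x i * E (l - 2)"
      "esym x (B - {i}) (l - 1) = E (l - 1) + x j * E (l - 2)"
      "esym x (B - {i}) l = E l + x j * E (l - 1)"
      using esym_remove[of "B - {j}" i x "l - 1"] esym_remove[of "B - {i}" j x "l - 1"]
        esym_remove[of "B - {i}" j x l] i finB
      by (simp_all add: E_def Diff_insert2[symmetric] insert_commute)
    moreover have "esym x B l = esym x (B - {i}) l + x i * esym x (B - {i}) (l - 1)"
      by (rule esym_remove[OF finB i(1)])
    moreover have "E (l - 2) * E l \<le> E (l - 1) * E (l - 1)"
      using esym_log_concave[of "B - {i} - {j}" x "l - 2" "l - 1"] finB pos
      by (simp add: E_def B_def less_imp_le)
    \<comment> \<open>Expanded in \<open>x i\<close> and \<open>x j\<close>, the two sides differ by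
      \<open>E (l - 1) * E (l - 1) - E (l - 2) * E l\<close>.\<close>
    ultimately have local: "E (l - 2) * esym x B l \<le> esym x (B - {j}) (l - 1) * esym x (B - {i}) (l - 1)"
      by (simp add: algebra_simps)
    have "card B = card A - card \<beta>" "card \<beta> \<le> card A"
      unfolding B_def using insert.hyps insert.prems fin
      by (auto intro!: card_Diff_subset card_mono)
    then have pos_B: "0 < esym x B l"
      using kA insert.prems insert.hyps finB pos by (intro esym_pos) (auto simp: l_def B_def)
    \<comment> \<open>Chaining \<open>local\<close> with the induction hypothesis leaves the common
      factor \<open>esym x B l\<close>, which is positive and cancels.\<close>
    have s1: "esym x B l * (E (l - 2) * esym x A k)
        \<le> (esym x (B - {j}) (l - 1) * esym x A k) * esym x (B - {i}) (l - 1)"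
      using mult_right_mono[OF local, of "esym x A k"] esym_nonneg[of A x k] pos
      by (simp add: less_imp_le mult_ac)
    have s2: "(esym x (B - {j}) (l - 1) * esym x A k) * esym x (B - {i}) (l - 1)
        \<le> (esym x B l * esym x (A - {j}) (k - 1)) * esym x (B - {i}) (l - 1)"
      using IH pos by (intro mult_right_mono esym_nonneg) (auto simp: B_def less_imp_le)
    have "esym x B l * (E (l - 2) * esym x A k)
        \<le> esym x B l * (esym x (B - {i}) (l - 1) * esym x (A - {j}) (k - 1))"
      using order_trans[OF s1 s2] by (simp only: mult_ac)
    then have "E (l - 2) * esym x A k \<le> esym x (B - {i}) (l - 1) * esym x (A - {j}) (k - 1)"
      by (rule mult_left_le_imp_le) (rule pos_B)
    moreover have "A - insert i \<beta> = B - {i}" "k - int (card (insert i \<beta>)) = l - 1" "l - 1 - 1 = l - 2"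
      using insert.hyps by (auto simp: B_def l_def)
    ultimately show ?case unfolding E_def by simp
  qed (simp add: mult.commute)
  define P where "P = (\<Prod>j\<in>\<beta>. x j)"
  have P: "0 \<le> P" unfolding P_def using \<beta> pos by (intro prod_nonneg) (auto simp: less_imp_le)
  have xj: "0 < x j" by (rule pos[OF j])
  have Ek: "0 < esym x A k" using le kA by (intro esym_pos fin pos) auto
  have "j \<notin> \<beta>" using \<beta> by auto
  then have "cond_incl x A k (insert j \<beta>) =
      (P * x j) * (esym x (A - \<beta> - {j}) (k - int (card \<beta>) - 1) * esym x A k) / (esym x A k * esym x A k)"
    unfolding cond_incl_def using fin_\<beta> Ek
    by (simp add: Diff_insert2[symmetric] P_def diff_diff_eq add.commute mult_ac insert_commute flip: Diff_insert)
  also have "\<dots> \<le> (P * x j) * (esym x (A - \<beta>) (k - int (card \<beta>)) * esym x (A - {j}) (k - 1)) / (esym x A k * esym x A k)"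
    using key P xj Ek by (intro divide_right_mono mult_left_mono) auto
  also have "\<dots> = cond_incl x A k \<beta> * cond_incl x A k {j}"
    unfolding cond_incl_def P_def by simp
  finally show ?thesis .
qed

text \<open>A set of size \<open>k\<close> containing \<open>\<beta>\<close> has exactly
  \<open>k - card \<beta>\<close> further elements; formally this is size bias on
  \<open>A - \<beta>\<close>.\<close>

lemma sum_cond_incl_insert:
  assumes fin: "finite A" and \<beta>: "\<beta> \<subseteq> A"
  shows "(\<Sum>j\<in>A - \<beta>. cond_incl x A k (insert j \<beta>)) = (real_of_int k - real (card \<beta>)) * cond_incl x A k \<beta>"
proof -
  have fin_\<beta>: "finite \<beta>" using fin \<beta> by (meson finite_subset)
  have "(\<Sum>j\<in>A - \<beta>. cond_incl x A k (insert j \<beta>)) =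
      (\<Sum>j\<in>A - \<beta>. (\<Prod>j\<in>\<beta>. x j) / esym x A k * (x j * esym x (A - \<beta> - {j}) (k - int (card \<beta>) - 1)))"
  proof (rule sum.cong[OF refl])
    fix j assume "j \<in> A - \<beta>"
    moreover have "A - insert j \<beta> = A - \<beta> - {j}" by auto
    ultimately show "cond_incl x A k (insert j \<beta>) =
        (\<Prod>j\<in>\<beta>. x j) / esym x A k * (x j * esym x (A - \<beta> - {j}) (k - int (card \<beta>) - 1))"
      using fin_\<beta> by (simp add: cond_incl_def algebra_simps)
  qed
  also have "\<dots> = (\<Prod>j\<in>\<beta>. x j) / esym x A k *
      (real_of_int (k - int (card \<beta>)) * esym x (A - \<beta>) (k - int (card \<beta>)))"
    using esym_size_bias[of "A - \<beta>" "k - int (card \<beta>)" x] fin by (simp add: sum_distrib_left)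
  finally show ?thesis by (simp add: cond_incl_def)
qed

text \<open>A set with a further element corresponds to a set of size \<open>Suc m\<close> with one
  marked element, and there are \<open>Suc m\<close> choices of the mark.\<close>

lemma sum_subsets_Suc:
  fixes F :: "'a set \<Rightarrow> real"
  assumes fin: "finite A"
  shows "(\<Sum>\<beta> | \<beta> \<subseteq> A \<and> card \<beta> = m. \<Sum>j\<in>A - \<beta>. F (insert j \<beta>)) =
    real (Suc m) * (\<Sum>\<beta> | \<beta> \<subseteq> A \<and> card \<beta> = Suc m. F \<beta>)"
proof -
  have fins: "finite {\<beta>. \<beta> \<subseteq> A \<and> card \<beta> = l}" "\<And>\<beta>. \<beta> \<subseteq> A \<Longrightarrow> finite \<beta>" for l
    using fin by (auto intro: finite_subset)
  have "(\<Sum>\<beta> | \<beta> \<subseteq> A \<and> card \<beta> = m. \<Sum>j\<in>A - \<beta>. F (insert j \<beta>)) =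
      (\<Sum>(\<beta>, j)\<in>Sigma {\<beta>. \<beta> \<subseteq> A \<and> card \<beta> = m} (\<lambda>\<beta>. A - \<beta>). F (insert j \<beta>))"
    using fins fin by (intro sum.Sigma) auto
  also have "\<dots> = (\<Sum>(\<beta>, j)\<in>Sigma {\<beta>. \<beta> \<subseteq> A \<and> card \<beta> = Suc m} (\<lambda>\<beta>. \<beta>). F \<beta>)"
    using fins
    by (intro sum.reindex_bij_witness[of _ "\<lambda>(\<beta>, j). (\<beta> - {j}, j)" "\<lambda>(\<beta>, j). (insert j \<beta>, j)"])
      (auto simp: insert_absorb)
  also have "\<dots> = (\<Sum>\<beta> | \<beta> \<subseteq> A \<and> card \<beta> = Suc m. \<Sum>j\<in>\<beta>. F \<beta>)"
    using fins by (intro sum.Sigma[symmetric]) auto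
  finally show ?thesis by (simp add: sum_distrib_left)
qed

text \<open>The sum is the expected number of \<open>m\<close>-subsets of a set of size
  \<open>k\<close>, that is \<open>k choose m\<close>. The cruder power follows by adding one
  element at a time.\<close>

lemma sum_cond_incl_le:
  assumes fin: "finite A" and pos: "\<And>j. j \<in> A \<Longrightarrow> 0 < x j" and k: "0 \<le> k" "k \<le> int (card A)"
  shows "(\<Sum>\<beta> | \<beta> \<subseteq> A \<and> card \<beta> = m. cond_incl x A k \<beta>) \<le> real_of_int k ^ m"
proof (induction m)
  case 0
  have "{\<beta>. \<beta> \<subseteq> A \<and> card \<beta> = 0} = {{}}" using fin by (auto dest: finite_subset)
  then show ?case using esym_pos[OF fin pos k] by (simp add: cond_incl_def)
next
  case (Suc m)
  define S where "S = (\<lambda>m. \<Sum>\<beta> | \<beta> \<subseteq> A \<and> card \<beta> = m. cond_incl x A k \<beta>)"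
  have S: "0 \<le> S m" for m
    unfolding S_def by (intro sum_nonneg cond_incl_nonneg) (auto simp: pos less_imp_le)
  have "S (Suc m) \<le> real (Suc m) * S (Suc m)" using S[of "Suc m"] by (simp add: distrib_right)
  also have "\<dots> = (\<Sum>\<beta> | \<beta> \<subseteq> A \<and> card \<beta> = m. \<Sum>j\<in>A - \<beta>. cond_incl x A k (insert j \<beta>))"
    unfolding S_def by (rule sum_subsets_Suc[OF fin, symmetric])
  also have "\<dots> = (\<Sum>\<beta> | \<beta> \<subseteq> A \<and> card \<beta> = m. (real_of_int k - real m) * cond_incl x A k \<beta>)"
    by (intro sum.cong) (auto simp: sum_cond_incl_insert[OF fin])
  also have "\<dots> = (real_of_int k - real m) * S m" by (simp add: S_def sum_distrib_left)
  also have "\<dots> \<le> real_of_int k * S m" using S by (intro mult_right_mono) auto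
  also have "\<dots> \<le> real_of_int k * real_of_int k ^ m" using Suc k by (intro mult_left_mono) (auto simp: S_def)
  finally show ?case by (simp add: S_def)
qed

text \<open>
  In the induction step the law is compared with the conditional law given inclusion of \<open>\<beta>\<close>.
  By negative correlation the terms \<open>P(\<beta>) P({j}) - P(\<beta> \<union> {j})\<close> are nonnegative, so their absolute
  values can be summed exactly.
\<close>

lemma cond_incl_l1:
  assumes fin: "finite A" and pos: "\<And>j. j \<in> A \<Longrightarrow> 0 < x j"
    and k: "1 \<le> k" and mean: "(\<Sum>j\<in>A. x j / (1 + x j)) = real_of_int k"
    and m: "int m \<le> k"
  shows "(\<Sum>\<beta> | \<beta> \<subseteq> A \<and> card \<beta> = m. \<bar>cond_incl x A k \<beta> - (\<Prod>j\<in>\<beta>. x j / (1 + x j))\<bar>)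
    \<le> real m * (real m + 4) * real_of_int k ^ (m - 1)"
proof -
  define p where "p = (\<lambda>j. x j / (1 + x j))"
  define P where "P = cond_incl x A k"
  define S where "S = (\<lambda>m. \<Sum>\<beta> | \<beta> \<subseteq> A \<and> card \<beta> = m. \<bar>P \<beta> - (\<Prod>j\<in>\<beta>. p j)\<bar>)"
  have p: "0 < p j" "p j < 1" if "j \<in> A" for j
    unfolding p_def using pos[OF that] by (auto simp: field_simps)
  have ne: "A \<noteq> {}" using mean k by auto
  have "(\<Sum>j\<in>A. p j) < (\<Sum>j\<in>A. 1)" using p by (intro sum_strict_mono fin ne) auto
  then have k_card: "k < int (card A)" using mean by (simp add: p_def)
  have Ek: "0 < esym x A k" using k k_card by (intro esym_pos fin pos) auto
  have P0: "0 \<le> P \<beta>" if "\<beta> \<subseteq> A" for \<beta>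
    unfolding P_def using that pos by (intro cond_incl_nonneg) (auto simp: less_imp_le)
  have P1: "P {j} = x j * esym x (A - {j}) (k - 1) / esym x A k" for j
    by (simp add: P_def cond_incl_def)
  have l1: "(\<Sum>j\<in>A. \<bar>P {j} - p j\<bar>) \<le> 4"
    using esym_inclusion_l1[OF fin pos k mean] by (simp add: P1 p_def)
  have sumP1: "(\<Sum>j\<in>A. P {j}) = real_of_int k"
    using sum_cond_incl_insert[OF fin, of "{}" x k] Ek by (simp add: P_def cond_incl_def)
  have "S m \<le> real m * (real m + 4) * real_of_int k ^ (m - 1)"
    using m
  proof (induction m)
    case 0
    have "{\<beta>. \<beta> \<subseteq> A \<and> card \<beta> = 0} = {{}}" using fin by (auto dest: finite_subset)
    then show ?case using Ek by (simp add: S_def P_def cond_incl_def)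
  next
    case (Suc m)
    have inner: "(\<Sum>j\<in>A - \<beta>. \<bar>P (insert j \<beta>) - (\<Prod>i\<in>insert j \<beta>. p i)\<bar>) \<le>
        real_of_int k * \<bar>P \<beta> - (\<Prod>i\<in>\<beta>. p i)\<bar> + (real m + 4) * P \<beta>"
      if \<beta>: "\<beta> \<subseteq> A" "card \<beta> = m" for \<beta>
    proof -
      define q where "q = (\<Prod>i\<in>\<beta>. p i)"
      have fin_\<beta>: "finite \<beta>" using \<beta> fin finite_subset by blast
      \<comment> \<open>Split the difference through \<open>P \<beta> * P {j}\<close> and
        \<open>P \<beta> * p j\<close>. Negative correlation fixes the sign of the first
        part.\<close>
      have pt: "\<bar>P (insert j \<beta>) - (\<Prod>i\<in>insert j \<beta>. p i)\<bar> \<le>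
          \<bar>P \<beta> - q\<bar> * p j + (P \<beta> * P {j} - P (insert j \<beta>)) + P \<beta> * \<bar>P {j} - p j\<bar>"
        if j: "j \<in> A - \<beta>" for j
      proof -
        have "P (insert j \<beta>) \<le> P \<beta> * P {j}"
          unfolding P_def using \<beta> j Suc.prems k_card
          by (intro cond_incl_neg_corr fin pos) auto
        moreover have "(\<Prod>i\<in>insert j \<beta>. p i) = q * p j" using fin_\<beta> j by (simp add: q_def)
        moreover have "P (insert j \<beta>) - q * p j = (P (insert j \<beta>) - P \<beta> * P {j})
            + P \<beta> * (P {j} - p j) + (P \<beta> - q) * p j" by (simp add: algebra_simps)
        moreover have "\<bar>P \<beta> * (P {j} - p j)\<bar> = P \<beta> * \<bar>P {j} - p j\<bar>"
          using P0[OF \<beta>(1)] by (simp add: abs_mult)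
        moreover have "\<bar>(P \<beta> - q) * p j\<bar> = \<bar>P \<beta> - q\<bar> * p j"
          using p j by (simp add: abs_mult less_imp_le)
        ultimately show ?thesis by linarith
      qed
      have "(\<Sum>j\<in>A - \<beta>. \<bar>P (insert j \<beta>) - (\<Prod>i\<in>insert j \<beta>. p i)\<bar>) \<le>
         \<bar>P \<beta> - q\<bar> * (\<Sum>j\<in>A - \<beta>. p j) + (P \<beta> * (\<Sum>j\<in>A - \<beta>. P {j}) - (\<Sum>j\<in>A - \<beta>. P (insert j \<beta>)))
           + P \<beta> * (\<Sum>j\<in>A - \<beta>. \<bar>P {j} - p j\<bar>)"
        unfolding sum_distrib_left sum.distrib[symmetric] sum_subtractf[symmetric]
        by (rule sum_mono) (rule pt)
      \<comment> \<open>The middle bracket collapses to \<open>real m * P \<beta>\<close>; with the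
        4 from the one-element bound this is the coefficient \<open>real m + 4\<close>.\<close>
      also have "\<dots> \<le> \<bar>P \<beta> - q\<bar> * real_of_int k + (P \<beta> * real_of_int k - (real_of_int k - real m) * P \<beta>)
          + P \<beta> * 4"
      proof (intro add_mono mult_left_mono diff_mono P0 \<beta>(1))
        show "(\<Sum>j\<in>A - \<beta>. p j) \<le> real_of_int k"
          unfolding mean[symmetric] p_def[symmetric]
          using p by (intro sum_mono2 fin) (auto simp: less_imp_le)
        show "(\<Sum>j\<in>A - \<beta>. P {j}) \<le> real_of_int k"
          unfolding sumP1[symmetric] using P0 by (intro sum_mono2 fin) auto
        show "(real_of_int k - real m) * P \<beta> \<le> (\<Sum>j\<in>A - \<beta>. P (insert j \<beta>))"
          unfolding P_def sum_cond_incl_insert[OF fin \<beta>(1)] \<beta>(2) by simp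
        show "(\<Sum>j\<in>A - \<beta>. \<bar>P {j} - p j\<bar>) \<le> 4"
          by (rule order_trans[OF sum_mono2[OF fin] l1]) auto
      qed simp
      finally show ?thesis by (simp add: q_def algebra_simps)
    qed
    have "S (Suc m) \<le> real (Suc m) * S (Suc m)"
      unfolding S_def by (simp add: distrib_right sum_nonneg)
    also have "\<dots> = (\<Sum>\<beta> | \<beta> \<subseteq> A \<and> card \<beta> = m. \<Sum>j\<in>A - \<beta>. \<bar>P (insert j \<beta>) - (\<Prod>i\<in>insert j \<beta>. p i)\<bar>)"
      unfolding S_def by (rule sum_subsets_Suc[OF fin, symmetric])
    also have "\<dots> \<le> (\<Sum>\<beta> | \<beta> \<subseteq> A \<and> card \<beta> = m.
        real_of_int k * \<bar>P \<beta> - (\<Prod>i\<in>\<beta>. p i)\<bar> + (real m + 4) * P \<beta>)"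
      by (intro sum_mono inner) auto
    also have "\<dots> = real_of_int k * S m + (real m + 4) * (\<Sum>\<beta> | \<beta> \<subseteq> A \<and> card \<beta> = m. P \<beta>)"
      by (simp add: S_def sum.distrib sum_distrib_left)
    also have "\<dots> \<le> real_of_int k * (real m * (real m + 4) * real_of_int k ^ (m - 1))
        + (real m + 4) * real_of_int k ^ m"
      using Suc k k_card sum_cond_incl_le[of A x k m] fin pos
      by (intro add_mono mult_left_mono) (auto simp: P_def)
    \<comment> \<open>For \<open>m = 0\<close> the exponent \<open>m - 1\<close> truncates to 0,
      harmlessly, as its coefficient is 0.\<close>
    also have "\<dots> = (real m * (real m + 4) + (real m + 4)) * real_of_int k ^ m"
      by (cases m) (simp_all add: algebra_simps)
    also have "\<dots> \<le> (real (Suc m) * (real (Suc m) + 4)) * real_of_int k ^ m"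
      using k by (intro mult_right_mono) (auto simp: algebra_simps)
    finally show ?case by simp
  qed
  then show ?thesis by (simp add: S_def P_def p_def)
qed

section \<open>Determinants over finite index sets\<close>

text \<open>The Leibniz formula over an arbitrary index set, so that a principal minor is the same
  entry function on a smaller set, without renumbering.\<close>

definition set_det :: "'a set \<Rightarrow> ('a \<Rightarrow> 'a \<Rightarrow> real) \<Rightarrow> real" where
  "set_det S A = (\<Sum>\<sigma> | \<sigma> permutes S. of_int (sign \<sigma>) * (\<Prod>i\<in>S. A i (\<sigma> i)))"

lemma set_det_cong:
  assumes "\<And>i j. i \<in> S \<Longrightarrow> j \<in> S \<Longrightarrow> A i j = B i j"
  shows "set_det S A = set_det S B"
  unfolding set_det_def using assms
  by (intro sum.cong refl arg_cong2[of _ _ _ _ "(*)"] prod.cong) (auto simp: permutes_in_image)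

lemma det_mat_eq_set_det: "Determinant.det (mat n n (\<lambda>(i, j). A i j)) = set_det {..<n} A"
  unfolding Determinant.det_def set_det_def
  by (auto intro!: sum.cong prod.cong simp: atLeast0LessThan permutes_in_image)

text \<open>A common relabelling of rows and columns conjugates the permutations, which keeps their
  signs.\<close>

lemma set_det_reindex:
  assumes h: "bij_betw h S T" and fin: "finite S"
  shows "set_det S (\<lambda>i j. A (h i) (h j)) = set_det T A"
proof -
  have inj: "inj_on h S" and img: "h ` S = T" using h by (auto simp: bij_betw_def)
  have "bij_betw (map_permutation S h) {\<pi>. \<pi> permutes S} {\<pi>. \<pi> permutes T}"
  proof -
    have "map_permutation S h = (\<lambda>\<pi> x. if x \<in> T then h (\<pi> (inv_into S h x)) else x)"
      using img by (auto simp: map_permutation_def restrict_id_def fun_eq_iff)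
    then show ?thesis using bij_betw_permutations[OF h] by simp
  qed
  then have "set_det T A = (\<Sum>\<sigma> | \<sigma> permutes S. of_int (sign (map_permutation S h \<sigma>)) *
      (\<Prod>i\<in>T. A i (map_permutation S h \<sigma> i)))"
    unfolding set_det_def
    by (subst sum.reindex_bij_betw[of "map_permutation S h" "{\<pi>. \<pi> permutes S}", symmetric]) auto
  also have "\<dots> = set_det S (\<lambda>i j. A (h i) (h j))"
    unfolding set_det_def
  proof (rule sum.cong[OF refl])
    fix \<sigma> assume "\<sigma> \<in> {\<sigma>. \<sigma> permutes S}"
    then have \<sigma>: "\<sigma> permutes S" by simp
    have "(\<Prod>i\<in>T. A i (map_permutation S h \<sigma> i)) = (\<Prod>i\<in>S. A (h i) (map_permutation S h \<sigma> (h i)))"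
      by (rule prod.reindex_bij_betw[OF h, symmetric])
    also have "\<dots> = (\<Prod>i\<in>S. A (h i) (h (\<sigma> i)))"
      by (intro prod.cong) (auto simp: map_permutation_apply[OF inj])
    finally show "of_int (sign (map_permutation S h \<sigma>)) * (\<Prod>i\<in>T. A i (map_permutation S h \<sigma> i)) =
        of_int (sign \<sigma>) * (\<Prod>i\<in>S. A (h i) (h (\<sigma> i)))"
      by (simp add: sign_map_permutation[OF inj \<sigma> fin])
  qed
  finally show ?thesis ..
qed

lemma set_det_transpose:
  assumes "finite S"
  shows "set_det S (\<lambda>i j. A j i) = set_det S A"
proof -
  have "set_det S (\<lambda>i j. A j i) = (\<Sum>\<sigma> | \<sigma> permutes S. of_int (sign (Hilbert_Choice.inv \<sigma>)) * (\<Prod>i\<in>S. A (Hilbert_Choice.inv \<sigma> i) i))"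
    unfolding set_det_def by (rule sum_permutations_inverse)
  also have "\<dots> = set_det S A"
    unfolding set_det_def
  proof (rule sum.cong[OF refl])
    fix \<sigma> assume "\<sigma> \<in> {\<sigma>. \<sigma> permutes S}"
    then have \<sigma>: "\<sigma> permutes S" by simp
    have "(\<Prod>i\<in>S. A (Hilbert_Choice.inv \<sigma> i) i) = (\<Prod>i\<in>S. A (Hilbert_Choice.inv \<sigma> (\<sigma> i)) (\<sigma> i))"
      using prod.permute[OF \<sigma>, of "\<lambda>i. A (Hilbert_Choice.inv \<sigma> i) i"] by (simp add: o_def)
    then show "of_int (sign (Hilbert_Choice.inv \<sigma>)) * (\<Prod>i\<in>S. A (Hilbert_Choice.inv \<sigma> i) i) = of_int (sign \<sigma>) * (\<Prod>i\<in>S. A i (\<sigma> i))"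
      using \<sigma> assms by (simp add: sign_inverse permutation_permutes permutes_inverses)
         (metis assms permutation_permutes sign_inverse)
  qed
  finally show ?thesis .
qed

lemma set_det_permute_rows:
  assumes "finite S" "\<tau> permutes S"
  shows "set_det S (\<lambda>i. A (\<tau> i)) = of_int (sign \<tau>) * set_det S A"
proof -
  have perm: "permutation \<sigma>" if "\<sigma> permutes S" for \<sigma> using assms(1) that permutation_permutes by blast
  have "set_det S (\<lambda>i. A (\<tau> i)) = (\<Sum>\<sigma> | \<sigma> permutes S. of_int (sign (\<sigma> \<circ> \<tau>)) * (\<Prod>i\<in>S. A (\<tau> i) ((\<sigma> \<circ> \<tau>) i)))"
    unfolding set_det_def by (rule sum_permutations_compose_right[OF assms(2)])
  also have "\<dots> = (\<Sum>\<sigma> | \<sigma> permutes S. of_int (sign \<tau>) * (of_int (sign \<sigma>) * (\<Prod>i\<in>S. A i (\<sigma> i))))"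
  proof (rule sum.cong[OF refl])
    fix \<sigma> assume "\<sigma> \<in> {\<sigma>. \<sigma> permutes S}"
    then have \<sigma>: "\<sigma> permutes S" by simp
    have "(\<Prod>i\<in>S. A (\<tau> i) ((\<sigma> \<circ> \<tau>) i)) = (\<Prod>i\<in>S. A i (\<sigma> i))"
      using prod.permute[OF assms(2), of "\<lambda>i. A i (\<sigma> i)"] by (simp add: o_def)
    then show "of_int (sign (\<sigma> \<circ> \<tau>)) * (\<Prod>i\<in>S. A (\<tau> i) ((\<sigma> \<circ> \<tau>) i)) =
        of_int (sign \<tau>) * (of_int (sign \<sigma>) * (\<Prod>i\<in>S. A i (\<sigma> i)))"
      by (simp add: sign_compose perm \<sigma> assms(2) mult_ac del: o_apply)
  qed
  finally show ?thesis by (simp add: set_det_def sum_distrib_left)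
qed

lemma set_det_identical_rows:
  assumes fin: "finite S" and ij: "i \<in> S" "j \<in> S" "i \<noteq> j" and eq: "\<And>l. l \<in> S \<Longrightarrow> A i l = A j l"
  shows "set_det S A = 0"
proof -
  define \<tau> where "\<tau> = Transposition.transpose i j"
  have \<tau>: "\<tau> permutes S" unfolding \<tau>_def using ij by (intro permutes_swap_id) auto
  have "set_det S (\<lambda>i. A (\<tau> i)) = set_det S A"
    using eq by (intro set_det_cong) (auto simp: \<tau>_def Transposition.transpose_def)
  then show ?thesis
    using set_det_permute_rows[OF fin \<tau>, of A] ij(3) by (simp add: \<tau>_def sign_swap_id)
qed

lemma bij_betw_pick:
  assumes "finite X"
  shows "bij_betw (pick X) {..<card X} X"
proof -
  have inj: "inj_on (pick X) {..<card X}"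
    using card_pick_le[of _ X] by (intro inj_onI) (metis lessThan_iff)
  moreover have "pick X ` {..<card X} = X"
    using pick_in_set_le[of _ X] card_image[OF inj] assms by (intro card_subset_eq) auto
  ultimately show ?thesis by (simp add: bij_betw_def)
qed

text \<open>\<open>submatrix\<close> numbers rows and columns through \<open>pick\<close>;
  reindexing along \<open>pick X\<close> undoes this.\<close>

lemma principal_minor_eq_set_det:
  assumes "L \<in> carrier_mat n n" "X \<subseteq> {..<n}"
  shows "principal_minor L X = set_det X (\<lambda>i j. L $$ (i, j))"
proof -
  have fin: "finite X" using assms(2) finite_subset by blast
  have "{i. i < n \<and> i \<in> X} = X" using assms(2) by auto
  then have "submatrix L X X = mat (card X) (card X) (\<lambda>(i, j). L $$ (pick X i, pick X j))"
    unfolding submatrix_def using assms(1) by auto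
  then have "principal_minor L X = set_det {..<card X} (\<lambda>i j. L $$ (pick X i, pick X j))"
    by (simp add: principal_minor_def det_mat_eq_set_det)
  also have "\<dots> = set_det X (\<lambda>i j. L $$ (i, j))"
    by (rule set_det_reindex[OF bij_betw_pick[OF fin]]) simp
  finally show ?thesis .
qed

text \<open>Expand over the set \<open>X\<close> of rows that take the entry of
  \<open>z * A\<close>. Every other row must take its diagonal 1, so it lies outside
  \<open>\<alpha>\<close> and is fixed by \<open>\<sigma>\<close>; a determinant over
  \<open>X\<close> remains. The power of \<open>z\<close> records the size of
  \<open>X\<close>.\<close>

lemma set_det_add_diagonal:
  assumes fin: "finite S" and \<alpha>: "\<alpha> \<subseteq> S"
  shows "set_det S (\<lambda>i j. z * A i j + (if i \<notin> \<alpha> \<and> i = j then 1 else 0)) =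
    (\<Sum>X | \<alpha> \<subseteq> X \<and> X \<subseteq> S. z ^ card X * set_det X A)"
proof -
  have "set_det S (\<lambda>i j. z * A i j + (if i \<notin> \<alpha> \<and> i = j then 1 else 0)) =
     (\<Sum>\<sigma> | \<sigma> permutes S. \<Sum>X\<in>Pow S. of_int (sign \<sigma>) * ((\<Prod>i\<in>X. z * A i (\<sigma> i)) *
        (\<Prod>i\<in>S - X. if i \<notin> \<alpha> \<and> i = \<sigma> i then 1 else 0)))"
    unfolding set_det_def prod_add[OF fin] sum_distrib_left ..
  also have "\<dots> = (\<Sum>X\<in>Pow S. \<Sum>\<sigma> | \<sigma> permutes S. of_int (sign \<sigma>) * ((\<Prod>i\<in>X. z * A i (\<sigma> i)) *
        (\<Prod>i\<in>S - X. if i \<notin> \<alpha> \<and> i = \<sigma> i then 1 else 0)))"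
    by (rule sum.swap)
  also have "\<dots> = (\<Sum>X\<in>Pow S. if \<alpha> \<subseteq> X then z ^ card X * set_det X A else 0)"
  proof (rule sum.cong[OF refl])
    fix X assume "X \<in> Pow S"
    then have X: "X \<subseteq> S" by simp
    have fin': "finite (S - X)" using fin by simp
    show "(\<Sum>\<sigma> | \<sigma> permutes S. of_int (sign \<sigma>) * ((\<Prod>i\<in>X. z * A i (\<sigma> i)) *
        (\<Prod>i\<in>S - X. if i \<notin> \<alpha> \<and> i = \<sigma> i then 1 else 0))) =
        (if \<alpha> \<subseteq> X then z ^ card X * set_det X A else 0)"
    proof (cases "\<alpha> \<subseteq> X")
      case False
      then obtain a where "a \<in> S - X" "a \<in> \<alpha>" using \<alpha> by auto
      then have "(\<Prod>i\<in>S - X. if i \<notin> \<alpha> \<and> i = \<sigma> i then 1 else 0) = (0::real)" for \<sigma>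
        using fin' by (intro prod_zero) auto
      then show ?thesis using False by simp
    next
      case True
      have "(\<Sum>\<sigma> | \<sigma> permutes S. of_int (sign \<sigma>) * ((\<Prod>i\<in>X. z * A i (\<sigma> i)) *
          (\<Prod>i\<in>S - X. if i \<notin> \<alpha> \<and> i = \<sigma> i then 1 else 0))) =
        (\<Sum>\<sigma> | \<sigma> permutes X. of_int (sign \<sigma>) * (\<Prod>i\<in>X. z * A i (\<sigma> i)))"
      proof (rule sum.mono_neutral_cong_right)
        show "finite {\<sigma>. \<sigma> permutes S}" by (rule finite_permutations[OF fin])
        show "{\<sigma>. \<sigma> permutes X} \<subseteq> {\<sigma>. \<sigma> permutes S}" using permutes_subset[OF _ X] by auto
        show "\<forall>\<sigma>\<in>{\<sigma>. \<sigma> permutes S} - {\<sigma>. \<sigma> permutes X}. of_int (sign \<sigma>) * ((\<Prod>i\<in>X. z * A i (\<sigma> i)) *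
          (\<Prod>i\<in>S - X. if i \<notin> \<alpha> \<and> i = \<sigma> i then 1 else 0)) = 0"
        proof
          fix \<sigma> assume \<sigma>: "\<sigma> \<in> {\<sigma>. \<sigma> permutes S} - {\<sigma>. \<sigma> permutes X}"
          then obtain i where "i \<in> S - X" "\<sigma> i \<noteq> i" using permutes_superset[of \<sigma> S X] by auto
          then have "(\<Prod>i\<in>S - X. if i \<notin> \<alpha> \<and> i = \<sigma> i then 1 else 0) = (0::real)"
            using fin' by (intro prod_zero bexI[of _ i]) auto
          then show "of_int (sign \<sigma>) * ((\<Prod>i\<in>X. z * A i (\<sigma> i)) *
            (\<Prod>i\<in>S - X. if i \<notin> \<alpha> \<and> i = \<sigma> i then 1 else 0)) = 0" by simp
        qed
        fix \<sigma> assume "\<sigma> \<in> {\<sigma>. \<sigma> permutes X}"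
        then have "(\<Prod>i\<in>S - X. if i \<notin> \<alpha> \<and> i = \<sigma> i then 1 else 0) = (1::real)"
          using True by (intro prod.neutral) (auto simp: permutes_def)
        then show "of_int (sign \<sigma>) * ((\<Prod>i\<in>X. z * A i (\<sigma> i)) *
          (\<Prod>i\<in>S - X. if i \<notin> \<alpha> \<and> i = \<sigma> i then 1 else 0)) = of_int (sign \<sigma>) * (\<Prod>i\<in>X. z * A i (\<sigma> i))"
          by simp
      qed
      also have "\<dots> = z ^ card X * set_det X A"
        by (simp add: set_det_def sum_distrib_left prod.distrib mult_ac)
      finally show ?thesis using True by simp
    qed
  qed
  also have "\<dots> = (\<Sum>X | \<alpha> \<subseteq> X \<and> X \<subseteq> S. z ^ card X * set_det X A)"
    using fin by (intro sum.mono_neutral_cong_right) auto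
  finally show ?thesis .
qed

text \<open>A unit column contributes only on the diagonal, so only permutations fixing everything
  outside \<open>\<alpha>\<close> survive.\<close>

lemma set_det_unit_columns:
  assumes fin: "finite S" and \<alpha>: "\<alpha> \<subseteq> S"
  shows "set_det S (\<lambda>i j. if j \<in> \<alpha> then A i j else if i = j then 1 else 0) = set_det \<alpha> A"
proof -
  let ?B = "\<lambda>i j. if j \<in> \<alpha> then A i j else if i = j then 1 else 0"
  have "(\<Sum>\<sigma> | \<sigma> permutes S. of_int (sign \<sigma>) * (\<Prod>i\<in>S. ?B i (\<sigma> i))) =
      (\<Sum>\<sigma> | \<sigma> permutes \<alpha>. of_int (sign \<sigma>) * (\<Prod>i\<in>\<alpha>. A i (\<sigma> i)))"
  proof (rule sum.mono_neutral_cong_right)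
    show "finite {\<sigma>. \<sigma> permutes S}" by (rule finite_permutations[OF fin])
    show "{\<sigma>. \<sigma> permutes \<alpha>} \<subseteq> {\<sigma>. \<sigma> permutes S}" using permutes_subset[OF _ \<alpha>] by auto
    show "\<forall>\<sigma>\<in>{\<sigma>. \<sigma> permutes S} - {\<sigma>. \<sigma> permutes \<alpha>}. of_int (sign \<sigma>) * (\<Prod>i\<in>S. ?B i (\<sigma> i)) = 0"
    proof
      fix \<sigma> assume \<sigma>: "\<sigma> \<in> {\<sigma>. \<sigma> permutes S} - {\<sigma>. \<sigma> permutes \<alpha>}"
      then have "\<exists>x\<in>S - \<alpha>. \<sigma> x \<noteq> x" using permutes_superset[of \<sigma> S \<alpha>] by auto
      then obtain x where x: "x \<in> S" "x \<notin> \<alpha>" "\<sigma> x \<noteq> x" by auto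
      \<comment> \<open>The row from which \<open>\<sigma>\<close> reaches column \<open>x\<close>;
        it differs from \<open>x\<close>, so its entry there is 0.\<close>
      define y where "y = Hilbert_Choice.inv \<sigma> x"
      have perm: "\<sigma> permutes S" using \<sigma> by simp
      then have y: "y \<in> S" "\<sigma> y = x"
        unfolding y_def using x(1) by (simp_all add: permutes_inverses permutes_in_image permutes_inv)
      then have "?B y (\<sigma> y) = 0" using x by auto
      then have "(\<Prod>i\<in>S. ?B i (\<sigma> i)) = 0" using y(1) by (intro prod_zero[OF fin] bexI[of _ y])
      then show "of_int (sign \<sigma>) * (\<Prod>i\<in>S. ?B i (\<sigma> i)) = 0" by simp
    qed
    fix \<sigma> assume "\<sigma> \<in> {\<sigma>. \<sigma> permutes \<alpha>}"
    then have \<sigma>: "\<sigma> permutes \<alpha>" by simp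
    have "(\<Prod>i\<in>S. ?B i (\<sigma> i)) = (\<Prod>i\<in>\<alpha>. A i (\<sigma> i))"
      using \<sigma> fin \<alpha>
      by (intro prod.mono_neutral_cong_right) (auto simp: permutes_in_image permutes_not_in)
    then show "of_int (sign \<sigma>) * (\<Prod>i\<in>S. ?B i (\<sigma> i)) = of_int (sign \<sigma>) * (\<Prod>i\<in>\<alpha>. A i (\<sigma> i))" by simp
  qed
  then show ?thesis by (simp add: set_det_def)
qed

section \<open>The Cauchy-Binet formula for weighted Gram matrices\<close>

text \<open>An injective \<open>f\<close> amounts to its image \<open>\<beta>\<close> and a
  permutation comparing it with the fixed enumeration \<open>e \<beta>\<close>, so each
  \<open>\<beta>\<close> accounts for \<open>fact m\<close> functions.\<close>

lemma sum_functions_eq_sum_subsets: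
  fixes G :: "(nat \<Rightarrow> 'a) \<Rightarrow> real"
  assumes fin: "finite N"
    and e: "\<And>\<beta>. \<beta> \<subseteq> N \<Longrightarrow> card \<beta> = m \<Longrightarrow> bij_betw (e \<beta>) {..<m} \<beta>"
    and inj0: "\<And>f. f \<in> {..<m} \<rightarrow>\<^sub>E N \<Longrightarrow> \<not> inj_on f {..<m} \<Longrightarrow> G f = 0"
    and sym: "\<And>f \<beta> \<sigma>. \<sigma> permutes {..<m} \<Longrightarrow> \<beta> \<subseteq> N \<Longrightarrow> card \<beta> = m \<Longrightarrow>
      (\<And>i. i < m \<Longrightarrow> f i = e \<beta> (\<sigma> i)) \<Longrightarrow> G f = H \<beta>"
  shows "(\<Sum>f\<in>{..<m} \<rightarrow>\<^sub>E N. G f) = fact m * (\<Sum>\<beta> | \<beta> \<subseteq> N \<and> card \<beta> = m. H \<beta>)"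
proof -
  let ?F = "{f \<in> {..<m} \<rightarrow>\<^sub>E N. inj_on f {..<m}}"
  let ?B = "{\<beta>. \<beta> \<subseteq> N \<and> card \<beta> = m}"
  let ?P = "{\<sigma>. \<sigma> permutes {..<m}}"
  let ?g = "\<lambda>(\<beta>, \<sigma>). restrict (e \<beta> \<circ> \<sigma>) {..<m}"
  have finF: "finite ({..<m} \<rightarrow>\<^sub>E N)" using fin by (intro finite_PiE) auto
  have bij: "bij_betw ?g (?B \<times> ?P) ?F"
  proof (rule bij_betwI')
    fix p q assume pq: "p \<in> ?B \<times> ?P" "q \<in> ?B \<times> ?P"
    obtain \<beta> \<sigma> \<gamma> \<tau> where p: "p = (\<beta>, \<sigma>)" and q: "q = (\<gamma>, \<tau>)" by fastforce
    have \<beta>: "\<beta> \<in> ?B" "\<gamma> \<in> ?B" "\<sigma> permutes {..<m}" "\<tau> permutes {..<m}" using pq p q by auto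
    have img: "?g (\<beta>, \<sigma>) ` {..<m} = \<beta>" if "\<beta> \<in> ?B" "\<sigma> permutes {..<m}" for \<beta> \<sigma>
    proof -
      have "?g (\<beta>, \<sigma>) ` {..<m} = e \<beta> ` \<sigma> ` {..<m}" by auto
      then show ?thesis using e[of \<beta>] that permutes_image[OF that(2)] by (simp add: bij_betw_def)
    qed
    show "(?g p = ?g q) = (p = q)"
    proof
      assume eq: "?g p = ?g q"
      then have "\<beta> = \<gamma>" using img[OF \<beta>(1,3)] img[OF \<beta>(2,4)] unfolding p q by metis
      have "\<sigma> i = \<tau> i" for i
      proof (cases "i < m")
        case True
        then have "e \<beta> (\<sigma> i) = e \<beta> (\<tau> i)"
          using fun_cong[OF eq, of i] by (simp add: p q \<open>\<beta> = \<gamma>\<close>)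
        moreover have "\<sigma> i < m" "\<tau> i < m"
          using \<beta>(3,4) True permutes_in_image[of _ "{..<m}" i] by auto
        ultimately show ?thesis
          using e[of \<beta>] \<beta>(1) by (auto simp: bij_betw_def inj_on_def)
      next
        case False
        then show ?thesis using \<beta>(3,4) by (simp add: permutes_def)
      qed
      with \<open>\<beta> = \<gamma>\<close> show "p = q" by (auto simp: p q)
    qed simp
  next
    fix p assume "p \<in> ?B \<times> ?P"
    then obtain \<beta> \<sigma> where p: "p = (\<beta>, \<sigma>)" "\<beta> \<in> ?B" "\<sigma> permutes {..<m}" by auto
    have "bij_betw (e \<beta> \<circ> \<sigma>) {..<m} \<beta>"
      using e[of \<beta>] p permutes_imp_bij[OF p(3)] by (auto intro: bij_betw_trans)
    then show "?g p \<in> ?F"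
      using p by (auto simp: bij_betw_def inj_on_def)
  next
    fix f assume f: "f \<in> ?F"
    define \<beta> where "\<beta> = f ` {..<m}"
    have \<beta>: "\<beta> \<in> ?B" unfolding \<beta>_def using f by (auto simp: card_image)
    have e\<beta>: "bij_betw (e \<beta>) {..<m} \<beta>" using e \<beta> by auto
    have f\<beta>: "bij_betw f {..<m} \<beta>" using f by (simp add: bij_betw_def \<beta>_def)
    \<comment> \<open>\<open>f\<close> followed by the inverse of \<open>e \<beta>\<close>, extended
      by the identity since \<open>permutes\<close> prescribes the values outside.\<close>
    define \<sigma> where "\<sigma> = (\<lambda>i. if i < m then inv_into {..<m} (e \<beta>) (f i) else i)"
    have "bij_betw (inv_into {..<m} (e \<beta>) \<circ> f) {..<m} {..<m}"
      by (rule bij_betw_trans[OF f\<beta> bij_betw_inv_into[OF e\<beta>]])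
    then have "bij_betw \<sigma> {..<m} {..<m}"
      by (rule bij_betw_cong[THEN iffD1, rotated]) (simp add: \<sigma>_def)
    then have \<sigma>: "\<sigma> permutes {..<m}" by (rule bij_imp_permutes) (simp add: \<sigma>_def)
    have "e \<beta> (\<sigma> i) = f i" if "i < m" for i
      using that bij_betw_inv_into_right[OF e\<beta>, of "f i"] by (auto simp: \<sigma>_def \<beta>_def)
    then have "f = ?g (\<beta>, \<sigma>)" using f by (auto simp: fun_eq_iff PiE_def extensional_def)
    then show "\<exists>p\<in>?B \<times> ?P. f = ?g p" using \<beta> \<sigma> by blast
  qed
  have "(\<Sum>f\<in>{..<m} \<rightarrow>\<^sub>E N. G f) = (\<Sum>f\<in>?F. G f)"
    using finF inj0 by (intro sum.mono_neutral_right) auto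
  also have "\<dots> = (\<Sum>p\<in>?B \<times> ?P. G (?g p))" by (rule sum.reindex_bij_betw[OF bij, symmetric])
  also have "\<dots> = (\<Sum>p\<in>?B \<times> ?P. H (fst p))" by (intro sum.cong) (auto intro!: sym)
  also have "\<dots> = (\<Sum>\<beta>\<in>?B. \<Sum>\<sigma>\<in>?P. H \<beta>)" unfolding sum.cartesian_product by (simp add: split_def)
  also have "\<dots> = fact m * (\<Sum>\<beta>\<in>?B. H \<beta>)"
    by (simp add: card_permutations[of "{..<m}" m] sum_distrib_left)
  finally show ?thesis .
qed

text \<open>The discrete Andreief identity: the sum over all \<open>f\<close> of a product over
  coordinates factorises, which turns a sum of squared determinants into one determinant of
  sums.\<close>

lemma andreief:
  assumes fin: "finite N"
  shows "(\<Sum>f\<in>{..<m} \<rightarrow>\<^sub>E N. (\<Prod>i<m. d (f i)) * (set_det {..<m} (\<lambda>i i'. V i' (f i)))\<^sup>2) =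
    fact m * set_det {..<m} (\<lambda>i i'. \<Sum>j\<in>N. d j * V i j * V i' j)"
proof -
  let ?P = "{\<sigma>. \<sigma> permutes {..<m}}"
  let ?s = "\<lambda>\<sigma>. real_of_int (sign (\<sigma> :: nat \<Rightarrow> nat))"
  define A where "A = (\<lambda>i i'. \<Sum>j\<in>N. d j * V i j * V i' j)"
  have "(\<Sum>f\<in>{..<m} \<rightarrow>\<^sub>E N. (\<Prod>i<m. d (f i)) * (set_det {..<m} (\<lambda>i i'. V i' (f i)))\<^sup>2) =
    (\<Sum>f\<in>{..<m} \<rightarrow>\<^sub>E N. \<Sum>\<tau>\<in>?P. \<Sum>\<sigma>\<in>?P. ?s \<tau> * ?s \<sigma> * (\<Prod>i<m. d (f i) * V (\<tau> i) (f i) * V (\<sigma> i) (f i)))"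
    unfolding set_det_def power2_eq_square sum_product
    unfolding sum_distrib_left by (simp add: prod.distrib mult_ac)
  also have "\<dots> = (\<Sum>\<tau>\<in>?P. \<Sum>\<sigma>\<in>?P. \<Sum>f\<in>{..<m} \<rightarrow>\<^sub>E N. ?s \<tau> * ?s \<sigma> * (\<Prod>i<m. d (f i) * V (\<tau> i) (f i) * V (\<sigma> i) (f i)))"
    by (subst sum.swap, intro sum.cong refl sum.swap)
  also have "\<dots> = (\<Sum>\<tau>\<in>?P. \<Sum>\<sigma>\<in>?P. ?s \<tau> * ?s \<sigma> * (\<Prod>i<m. A (\<tau> i) (\<sigma> i)))"
    unfolding A_def
    by (subst prod_sum_PiE) (auto simp: fin sum_distrib_left)
  \<comment> \<open>Each \<open>\<tau>\<close> permutes the rows and also carries its own sign; the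
    signs cancel and all \<open>fact m\<close> terms agree.\<close>
  also have "\<dots> = (\<Sum>\<tau>\<in>?P. set_det {..<m} A)"
  proof (rule sum.cong[OF refl])
    fix \<tau> assume "\<tau> \<in> ?P"
    then have \<tau>: "\<tau> permutes {..<m}" by simp
    have "(\<Sum>\<sigma>\<in>?P. ?s \<tau> * ?s \<sigma> * (\<Prod>i<m. A (\<tau> i) (\<sigma> i))) = ?s \<tau> * set_det {..<m} (\<lambda>i. A (\<tau> i))"
      by (simp add: set_det_def sum_distrib_left mult_ac)
    also have "\<dots> = ?s \<tau> * ?s \<tau> * set_det {..<m} A"
      by (simp add: set_det_permute_rows[OF _ \<tau>])
    also have "?s \<tau> * ?s \<tau> = 1" by (simp flip: of_int_mult)
    finally show "(\<Sum>\<sigma>\<in>?P. ?s \<tau> * ?s \<sigma> * (\<Prod>i<m. A (\<tau> i) (\<sigma> i))) = set_det {..<m} A" by simp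
  qed
  also have "\<dots> = fact m * set_det {..<m} A"
    by (simp add: card_permutations[of "{..<m}" m])
  finally show ?thesis unfolding A_def .
qed

text \<open>In Andreief's sum a non-injective \<open>f\<close> produces two equal rows, and all
  injective \<open>f\<close> with image \<open>\<beta>\<close> give the same squared minor, so
  \<open>fact m\<close> cancels.\<close>

lemma cauchy_binet_gram:
  fixes N :: "nat set"
  assumes fin: "finite N"
  shows "set_det {..<m} (\<lambda>i i'. \<Sum>j\<in>N. d j * V i j * V i' j) =
    (\<Sum>\<beta> | \<beta> \<subseteq> N \<and> card \<beta> = m. (\<Prod>j\<in>\<beta>. d j) * (set_det {..<m} (\<lambda>i i'. V i' (pick \<beta> i)))\<^sup>2)"
proof -
  have pick: "bij_betw (pick \<beta>) {..<m} \<beta>" if "\<beta> \<subseteq> N" "card \<beta> = m" for \<beta>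
    using bij_betw_pick[of \<beta>] that fin finite_subset by auto
  have "(\<Sum>f\<in>{..<m} \<rightarrow>\<^sub>E N. (\<Prod>i<m. d (f i)) * (set_det {..<m} (\<lambda>i i'. V i' (f i)))\<^sup>2) =
    fact m * (\<Sum>\<beta> | \<beta> \<subseteq> N \<and> card \<beta> = m. (\<Prod>j\<in>\<beta>. d j) * (set_det {..<m} (\<lambda>i i'. V i' (pick \<beta> i)))\<^sup>2)"
  proof (rule sum_functions_eq_sum_subsets[OF fin pick])
    fix f :: "nat \<Rightarrow> nat" assume "\<not> inj_on f {..<m}"
    then obtain i j where "i < m" "j < m" "i \<noteq> j" "f i = f j" by (auto simp: inj_on_def)
    then have "set_det {..<m} (\<lambda>i i'. V i' (f i)) = 0"
      by (intro set_det_identical_rows[of _ i j]) auto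
    then show "(\<Prod>i<m. d (f i)) * (set_det {..<m} (\<lambda>i i'. V i' (f i)))\<^sup>2 = 0" by simp
  next
    fix f \<beta> \<sigma> assume \<sigma>: "\<sigma> permutes {..<m}" and \<beta>: "\<beta> \<subseteq> N" "card \<beta> = m"
      and f: "\<And>i. i < m \<Longrightarrow> f i = pick \<beta> (\<sigma> i)"
    have "set_det {..<m} (\<lambda>i i'. V i' (f i)) = set_det {..<m} (\<lambda>i i'. V i' (pick \<beta> (\<sigma> i)))"
      using f by (intro set_det_cong) auto
    also have "\<dots> = of_int (sign \<sigma>) * set_det {..<m} (\<lambda>i i'. V i' (pick \<beta> i))"
      by (rule set_det_permute_rows[OF _ \<sigma>]) simp
    finally have det: "(set_det {..<m} (\<lambda>i i'. V i' (f i)))\<^sup>2 = (set_det {..<m} (\<lambda>i i'. V i' (pick \<beta> i)))\<^sup>2"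
      by (simp add: power_mult_distrib power2_eq_square[of "real_of_int _"] flip: of_int_mult)
    have "(\<Prod>i<m. d (f i)) = (\<Prod>i<m. d (pick \<beta> (\<sigma> i)))" using f by simp
    also have "\<dots> = (\<Prod>i<m. d (pick \<beta> i))"
      using prod.permute[OF \<sigma>, of "\<lambda>i. d (pick \<beta> i)"] by (simp add: o_def)
    also have "\<dots> = (\<Prod>j\<in>\<beta>. d j)" by (rule prod.reindex_bij_betw[OF pick[OF \<beta>]])
    finally show "(\<Prod>i<m. d (f i)) * (set_det {..<m} (\<lambda>i i'. V i' (f i)))\<^sup>2 =
       (\<Prod>j\<in>\<beta>. d j) * (set_det {..<m} (\<lambda>i i'. V i' (pick \<beta> i)))\<^sup>2" using det by simp
  qed
  then show ?thesis using andreief[OF fin, of d m V] by simp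
qed

section \<open>The spectral theorem for real symmetric matrices\<close>

text \<open>Over the complex numbers an eigenvalue \<open>c\<close> exists. At its eigenvector the
  Hermitian form \<open>q\<close> equals \<open>c * s\<close>, where \<open>s\<close> is the squared
  norm; \<open>q\<close> and \<open>s\<close> are real and \<open>s\<close> is nonzero, so
  \<open>c\<close> is real.\<close>

lemma real_symmetric_eigenvalue_exists:
  fixes A :: "real mat"
  assumes A: "A \<in> carrier_mat n n" and sym: "transpose_mat A = A" and n: "0 < n"
  shows "\<exists>e. eigenvalue A e"
proof -
  define C where "C = map_mat complex_of_real A"
  have C: "C \<in> carrier_mat n n" using A by (simp add: C_def)
  have hom: "char_poly C = map_poly complex_of_real (char_poly A)"
    unfolding C_def by (rule of_real_hom.char_poly_hom[OF A])
  obtain es where es: "char_poly C = (\<Prod>e\<leftarrow>es. [:- e, 1:])" "length es = n"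
    using char_poly_factorized[OF C] by auto
  with n obtain c where c: "poly (char_poly C) c = 0" by (cases es) auto
  then have "eigenvalue C c" using eigenvalue_root_char_poly[OF C] by simp
  then obtain v where v: "v \<in> carrier_vec n" "v \<noteq> 0\<^sub>v n" "C *\<^sub>v v = c \<cdot>\<^sub>v v"
    using C by (auto simp: eigenvalue_def eigenvector_def)
  define q where "q = (\<Sum>i<n. \<Sum>j<n. of_real (A $$ (i, j)) * v $ j * cnj (v $ i))"
  define s where "s = (\<Sum>i<n. v $ i * cnj (v $ i))"
  have Aij: "A $$ (j, i) = A $$ (i, j)" if "i < n" "j < n" for i j
    using that A arg_cong[OF sym, of "\<lambda>M. M $$ (i, j)"] by simp
  have row: "(\<Sum>j<n. of_real (A $$ (i, j)) * v $ j) = c * v $ i" if "i < n" for i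
    using arg_cong[OF v(3), of "\<lambda>w. w $ i"] that v(1) C A
    by (simp add: scalar_prod_def C_def atLeast0LessThan)
  have "q = c * s"
    unfolding q_def s_def sum_distrib_left
    by (intro sum.cong refl) (simp add: row flip: sum_distrib_right mult.assoc)
  moreover have "cnj q = q"
  proof -
    have "cnj q = (\<Sum>i<n. \<Sum>j<n. of_real (A $$ (i, j)) * cnj (v $ j) * v $ i)"
      by (simp add: q_def)
    also have "\<dots> = (\<Sum>j<n. \<Sum>i<n. of_real (A $$ (i, j)) * cnj (v $ j) * v $ i)"
      by (rule sum.swap)
    also have "\<dots> = q" unfolding q_def by (intro sum.cong refl) (simp add: Aij mult_ac)
    finally show ?thesis .
  qed
  moreover have "cnj s = s" by (simp add: s_def mult.commute)
  moreover have "s \<noteq> 0"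
  proof
    assume "s = 0"
    then have "(\<Sum>i<n. (cmod (v $ i))\<^sup>2) = 0"
      by (simp add: s_def complex_mult_cnj cmod_power2 flip: of_real_sum of_real_add of_real_power)
    then have "v $ i = 0" if "i < n" for i
      using that by (subst (asm) sum_nonneg_eq_0_iff) auto
    then show False using v(1,2) by auto
  qed
  ultimately have "cnj c = c" by (metis complex_cnj_mult mult_right_cancel)
  then obtain x where x: "c = complex_of_real x" by (metis Reals_cases Reals_cnj_iff)
  then have "poly (char_poly A) x = 0" using c hom by (simp add: of_real_hom.poly_map_poly)
  then show ?thesis using eigenvalue_root_char_poly[OF A] by blast
qed

text \<open>Complete \<open>v\<close> to a basis, apply Gram-Schmidt, which keeps the first vector,
  and normalise; the factor is the normalising constant.\<close>

lemma orthogonal_mat_with_first_col: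
  fixes v :: "real vec"
  assumes v: "v \<in> carrier_vec n" and v0: "v \<noteq> 0\<^sub>v n"
  shows "\<exists>W c. W \<in> carrier_mat n n \<and> transpose_mat W * W = 1\<^sub>m n \<and> col W 0 = c \<cdot>\<^sub>v v"
proof -
  interpret cof_vec_space n "TYPE(real)" .
  have n: "0 < n" using v v0 by (cases n) auto
  define b where "b = basis_completion v"
  define ws where "ws = gram_schmidt n b"
  from basis_completion[OF v v0, folded b_def]
  have dist_b: "distinct b" and indep: "\<not> lin_dep (set b)" and b: "set b \<subseteq> carrier_vec n"
    and hdb: "hd b = v" and len_b: "length b = n" by auto
  from hdb len_b n obtain vs where bv: "b = v # vs" by (cases b) auto
  from gram_schmidt_result[OF b dist_b indep refl, folded ws_def]
  have ws: "set ws \<subseteq> carrier_vec n" "corthogonal ws" "length ws = n" by (auto simp: len_b)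
  have hdws: "ws ! 0 = v"
    using gram_schmidt_hd[OF v, of vs, folded bv] ws(3) n
    by (metis hd_conv_nth length_greater_0_conv ws_def)
  have conj: "conjugate w = w" for w :: "real vec" by (rule eq_vecI) auto
  have wsi: "ws ! i \<in> carrier_vec n" if "i < n" for i using ws(1,3) that by auto
  have orth: "ws ! i \<bullet> ws ! j = 0 \<longleftrightarrow> i \<noteq> j" if "i < n" "j < n" for i j
    using ws(2,3) that unfolding corthogonal_def by (simp add: conj)
  have pos: "0 < ws ! i \<bullet> ws ! i" if "i < n" for i
  proof -
    have "0 \<le> ws ! i \<bullet> ws ! i" by (simp add: scalar_prod_def sum_nonneg)
    then show ?thesis using orth[of i i] that by linarith
  qed
  define c where "c = (\<lambda>i. 1 / sqrt (ws ! i \<bullet> ws ! i))"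
  define W where "W = mat_of_cols n (map (\<lambda>i. c i \<cdot>\<^sub>v ws ! i) [0..<n])"
  have W: "W \<in> carrier_mat n n" unfolding W_def using mat_of_cols_carrier(1)[of n "map (\<lambda>i. c i \<cdot>\<^sub>v ws ! i) [0..<n]"] by simp
  have colW: "col W i = c i \<cdot>\<^sub>v ws ! i" if "i < n" for i
    unfolding W_def using that wsi[OF that] by (subst col_mat_of_cols) auto
  have "transpose_mat W * W = 1\<^sub>m n"
  proof (rule eq_matI)
    fix i j assume "i < dim_row (1\<^sub>m n :: real mat)" "j < dim_col (1\<^sub>m n :: real mat)"
    then have ij: "i < n" "j < n" by auto
    have "(transpose_mat W * W) $$ (i, j) = col W i \<bullet> col W j" using ij W by simp
    also have "\<dots> = c i * c j * (ws ! i \<bullet> ws ! j)"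
      using colW ij wsi
      by (simp add: smult_scalar_prod_distrib[of _ n] scalar_prod_smult_distrib[of _ n])
    also have "\<dots> = (if i = j then 1 else 0)"
      using orth[OF ij] pos[OF ij(1)] by (auto simp: c_def)
    finally show "(transpose_mat W * W) $$ (i, j) = 1\<^sub>m n $$ (i, j)" using ij by simp
  qed (use W in auto)
  moreover have "col W 0 = c 0 \<cdot>\<^sub>v v" using colW[OF n] hdws by simp
  ultimately show ?thesis using W by blast
qed

abbreviation diagonal :: "nat \<Rightarrow> (nat \<Rightarrow> real) \<Rightarrow> real mat" where
  "diagonal n d \<equiv> mat n n (\<lambda>(i, j). if i = j then d i else 0)"

text \<open>Deflation: in an orthonormal basis that starts with an eigenvector, the first column
  vanishes below the diagonal and, by symmetry, the first row beside it. The remaining block is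
  symmetric of size \<open>n\<close>.\<close>

lemma real_spectral_decomposition:
  fixes A :: "real mat"
  assumes "A \<in> carrier_mat n n" "transpose_mat A = A"
  shows "\<exists>U d. U \<in> carrier_mat n n \<and> transpose_mat U * U = 1\<^sub>m n \<and> A = U * diagonal n d * transpose_mat U"
  using assms
proof (induction n arbitrary: A)
  case 0
  then show ?case by (intro exI[of _ "1\<^sub>m 0"] exI[of _ "\<lambda>_. 0"]) (auto intro!: eq_matI)
next
  case (Suc n)
  note A = Suc.prems(1) and sym = Suc.prems(2)
  let ?N = "Suc n"
  obtain e where "eigenvalue A e" using real_symmetric_eigenvalue_exists[OF A sym] by auto
  then obtain v where v: "v \<in> carrier_vec ?N" "v \<noteq> 0\<^sub>v ?N" "A *\<^sub>v v = e \<cdot>\<^sub>v v"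
    using A by (auto simp: eigenvalue_def eigenvector_def)
  obtain W c where W: "W \<in> carrier_mat ?N ?N" and WW: "transpose_mat W * W = 1\<^sub>m ?N"
    and W0: "col W 0 = c \<cdot>\<^sub>v v"
    using orthogonal_mat_with_first_col[OF v(1,2)] by blast
  have Wt: "transpose_mat W \<in> carrier_mat ?N ?N" using W by simp
  have WW': "W * transpose_mat W = 1\<^sub>m ?N" by (rule mat_mult_left_right_inverse[OF Wt W WW])
  define B where "B = transpose_mat W * A * W"
  have B: "B \<in> carrier_mat ?N ?N" using W A by (simp add: B_def)
  have B_sym: "transpose_mat B = B"
    unfolding B_def using W Wt A sym
    by (simp add: transpose_mult[of _ ?N ?N _ ?N] assoc_mult_mat[of _ ?N ?N _ ?N _ ?N])
  have AB: "A = W * B * transpose_mat W"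
  proof -
    have "W * B * transpose_mat W = (W * transpose_mat W) * A * (W * transpose_mat W)"
      unfolding B_def using W Wt A by (simp add: assoc_mult_mat[of _ ?N ?N _ ?N _ ?N])
    then show ?thesis using A by (simp add: WW')
  qed
  have B0: "B $$ (i, 0) = (if i = 0 then e else 0)" if "i < ?N" for i
  proof -
    have "A *\<^sub>v col W 0 = e \<cdot>\<^sub>v col W 0"
      using W0 v A by (simp add: mult_mat_vec smult_smult_assoc mult.commute)
    then have "col (A * W) 0 = e \<cdot>\<^sub>v col W 0" by (simp only: col_mult2[OF A W zero_less_Suc])
    then have "B $$ (i, 0) = col W i \<bullet> (e \<cdot>\<^sub>v col W 0)"
      using that W A by (simp add: B_def assoc_mult_mat[of _ ?N ?N _ ?N _ ?N])
    also have "\<dots> = e * (transpose_mat W * W) $$ (i, 0)" using that W by simp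
    finally show ?thesis using that by (simp add: WW)
  qed
  have B0': "B $$ (0, i) = (if i = 0 then e else 0)" if "i < ?N" for i
    using B0[OF that] arg_cong[OF B_sym, of "\<lambda>M. M $$ (0, i)"] that B by simp
  define E where "E = mat 1 1 (\<lambda>_. e)"
  define B3 where "B3 = mat n n (\<lambda>(i, j). B $$ (Suc i, Suc j))"
  have B3: "B3 \<in> carrier_mat n n" "E \<in> carrier_mat 1 1" by (simp_all add: B3_def E_def)
  have "transpose_mat B3 = B3"
  proof (rule eq_matI)
    fix i j assume "i < dim_row B3" "j < dim_col B3"
    then show "transpose_mat B3 $$ (i, j) = B3 $$ (i, j)"
      using arg_cong[OF B_sym, of "\<lambda>M. M $$ (Suc i, Suc j)"] B by (simp add: B3_def)
  qed (simp_all add: B3_def)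
  then obtain V d where V: "V \<in> carrier_mat n n" and VV: "transpose_mat V * V = 1\<^sub>m n"
    and B3_eq: "B3 = V * diagonal n d * transpose_mat V"
    using Suc.IH[OF B3(1)] by blast
  \<comment> \<open>The diagonalisation of the block, acting trivially on the first
    coordinate.\<close>
  define X where "X = four_block_mat (1\<^sub>m 1) (0\<^sub>m 1 n) (0\<^sub>m n 1) V"
  define d' where "d' = (\<lambda>i. if i = 0 then e else d (i - 1))"
  have X: "X \<in> carrier_mat ?N ?N" unfolding X_def using four_block_carrier_mat[OF _ V, of "1\<^sub>m 1" 1 1] by simp
  have Xt: "transpose_mat X = four_block_mat (1\<^sub>m 1) (0\<^sub>m 1 n) (0\<^sub>m n 1) (transpose_mat V)"
    unfolding X_def using V by (subst transpose_four_block_mat[of _ 1 1 _ n _ n]) auto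
  have D: "diagonal ?N d' = four_block_mat E (0\<^sub>m 1 n) (0\<^sub>m n 1) (diagonal n d)"
    by (rule eq_matI) (auto simp: d'_def E_def)
  have "B = four_block_mat E (0\<^sub>m 1 n) (0\<^sub>m n 1) B3"
    using B0 B0' B by (intro eq_matI) (auto simp: E_def B3_def)
  also have "\<dots> = X * diagonal ?N d' * transpose_mat X"
    unfolding D Xt unfolding X_def B3_eq using V B3(2)
      left_add_zero_mat[OF mult_carrier_mat[OF mult_carrier_mat[OF V mat_carrier], of "transpose_mat V"]]
    by (simp add: mult_four_block_mat[of _ 1 1 _ n _ n _ _ 1 _ n])
  finally have BX: "B = X * diagonal ?N d' * transpose_mat X" .
  have XX: "transpose_mat X * X = 1\<^sub>m ?N"
    unfolding Xt unfolding X_def using V VV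
    by (simp add: mult_four_block_mat[of _ 1 1 _ n _ n _ _ 1 _ n])
  define U where "U = W * X"
  have U: "U \<in> carrier_mat ?N ?N" using W X by (simp add: U_def)
  have Ut: "transpose_mat U = transpose_mat X * transpose_mat W"
    unfolding U_def by (rule transpose_mult[OF W X])
  have X': "transpose_mat X \<in> carrier_mat ?N ?N" using X by simp
  have "transpose_mat U * U = transpose_mat X * ((transpose_mat W * W) * X)"
    unfolding Ut unfolding U_def using W X Wt X' by (simp add: assoc_mult_mat[of _ ?N ?N _ ?N _ ?N])
  also have "\<dots> = 1\<^sub>m ?N" using X XX by (simp add: WW)
  finally have UU: "transpose_mat U * U = 1\<^sub>m ?N" .
  have M: "diagonal ?N d' \<in> carrier_mat ?N ?N" by simp
  have "A = W * ((X * diagonal ?N d') * transpose_mat X) * transpose_mat W"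
    unfolding AB BX ..
  also have "W * ((X * diagonal ?N d') * transpose_mat X) = W * (X * diagonal ?N d') * transpose_mat X"
    by (rule assoc_mult_mat[OF W mult_carrier_mat[OF X M] X', symmetric])
  also have "W * (X * diagonal ?N d') = U * diagonal ?N d'"
    unfolding U_def by (rule assoc_mult_mat[OF W X M, symmetric])
  also have "U * diagonal ?N d' * transpose_mat X * transpose_mat W = U * diagonal ?N d' * transpose_mat U"
    unfolding Ut by (rule assoc_mult_mat[OF mult_carrier_mat[OF U M] X' Wt])
  finally have "A = U * diagonal ?N d' * transpose_mat U" .
  with U UU show ?case by blast
qed

text \<open>The form in which the locale below takes the decomposition. Rows are orthonormal because
  a one-sided inverse of a square matrix is two-sided; the eigenvalues come from similarity with
  \<open>diagonal n d\<close>.\<close>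

lemma spectral_decomposition_coords:
  fixes A U :: "real mat"
  assumes U: "U \<in> carrier_mat n n" and UU: "transpose_mat U * U = 1\<^sub>m n"
    and A: "A = U * diagonal n d * transpose_mat U"
  shows "\<And>i j. i < n \<Longrightarrow> j < n \<Longrightarrow> A $$ (i, j) = (\<Sum>l<n. d l * U $$ (i, l) * U $$ (j, l))"
    and "\<And>i j. i < n \<Longrightarrow> j < n \<Longrightarrow> (\<Sum>l<n. U $$ (l, i) * U $$ (l, j)) = (if i = j then 1 else 0)"
    and "\<And>i j. i < n \<Longrightarrow> j < n \<Longrightarrow> (\<Sum>l<n. U $$ (i, l) * U $$ (j, l)) = (if i = j then 1 else 0)"
    and "eigvals A = mset (map d [0..<n])"
    and "A \<in> carrier_mat n n"
proof -
  have Ut: "transpose_mat U \<in> carrier_mat n n" using U by simp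
  have UU': "U * transpose_mat U = 1\<^sub>m n" by (rule mat_mult_left_right_inverse[OF Ut U UU])
  have D: "diagonal n d \<in> carrier_mat n n" by simp
  show A_car: "A \<in> carrier_mat n n"
    unfolding A by (rule mult_carrier_mat[OF mult_carrier_mat[OF U D] Ut])
  fix i j assume ij: "i < n" "j < n"
  have UD: "(U * diagonal n d) $$ (i, l) = d l * U $$ (i, l)" if "l < n" for l
  proof -
    have "(U * diagonal n d) $$ (i, l) = (\<Sum>k<n. U $$ (i, k) * (if k = l then d k else 0))"
      using U ij that by (simp add: scalar_prod_def atLeast0LessThan)
    also have "\<dots> = (\<Sum>k<n. if k = l then U $$ (i, k) * d k else 0)" by (intro sum.cong) auto
    finally show ?thesis using that by simp
  qed
  have "A $$ (i, j) = (\<Sum>l<n. (U * diagonal n d) $$ (i, l) * U $$ (j, l))"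
    unfolding A using U ij by (simp add: scalar_prod_def atLeast0LessThan)
  then show "A $$ (i, j) = (\<Sum>l<n. d l * U $$ (i, l) * U $$ (j, l))" using UD by simp
  show "(\<Sum>l<n. U $$ (l, i) * U $$ (l, j)) = (if i = j then 1 else 0)"
    using arg_cong[OF UU, of "\<lambda>M. M $$ (i, j)"] ij U by (simp add: scalar_prod_def atLeast0LessThan)
  show "(\<Sum>l<n. U $$ (i, l) * U $$ (j, l)) = (if i = j then 1 else 0)"
    using arg_cong[OF UU', of "\<lambda>M. M $$ (i, j)"] ij U by (simp add: scalar_prod_def atLeast0LessThan)
next
  have Ut: "transpose_mat U \<in> carrier_mat n n" using U by simp
  have UU': "U * transpose_mat U = 1\<^sub>m n" by (rule mat_mult_left_right_inverse[OF Ut U UU])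
  have "similar_mat A (diagonal n d)"
    using U Ut UU UU' A by (intro similar_matI[of _ _ U "transpose_mat U" n]) auto
  then have "char_poly A = char_poly (diagonal n d)" by (rule char_poly_similar)
  also have "\<dots> = (\<Prod>a\<leftarrow>diag_mat (diagonal n d). [:- a, 1:])"
    by (rule char_poly_upper_triangular[of _ n]) (auto simp: upper_triangular_def)
  also have "diag_mat (diagonal n d) = map d [0..<n]" by (auto simp: diag_mat_def)
  finally have "char_poly A = (\<Prod>a\<leftarrow>map d [0..<n]. [:- a, 1:])" .
  moreover have "proots (\<Prod>a\<leftarrow>as. [:- a, 1:]) = mset as" for as :: "real list"
  proof (induction as)
    case (Cons a as)
    have "(\<Prod>a\<leftarrow>as. [:- a, 1:]) \<noteq> 0" by (auto simp: prod_list_zero_iff)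
    then show ?case using Cons by (simp add: proots_mult del: mult_pCons_left)
  qed simp
  ultimately show "eigvals A = mset (map d [0..<n])" by (simp only: eigvals_def)
qed

section \<open>Inclusion probabilities\<close>

text \<open>Both sides are polynomials in \<open>t\<close> agreeing at infinitely many points, hence
  coefficientwise. This passes from generating functions to subsets of fixed size.\<close>

lemma sum_coeff_eq:
  fixes f :: "'a \<Rightarrow> real" and g :: "'b \<Rightarrow> real"
  assumes "finite I" "finite J"
    and eq: "\<And>t. t > 0 \<Longrightarrow> (\<Sum>x\<in>I. t ^ a x * f x) = (\<Sum>y\<in>J. t ^ b y * g y)"
  shows "(\<Sum>x | x \<in> I \<and> a x = k. f x) = (\<Sum>y | y \<in> J \<and> b y = k. g y)"
proof -
  define P where "P = (\<Sum>x\<in>I. Polynomial.monom (f x) (a x))"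
  define Q where "Q = (\<Sum>y\<in>J. Polynomial.monom (g y) (b y))"
  have "poly (P - Q) t = 0" if "t > 0" for t
    using eq[OF that] by (simp add: P_def Q_def poly_sum poly_monom mult.commute)
  then have "{0<..} \<subseteq> {t. poly (P - Q) t = 0}" by auto
  then have "infinite {t. poly (P - Q) t = 0}" using infinite_Ioi infinite_super by blast
  then have "P - Q = 0" using poly_roots_finite by blast
  then have "coeff P k = coeff Q k" by simp
  moreover have "coeff P k = (\<Sum>x | x \<in> I \<and> a x = k. f x)"
    unfolding P_def coeff_sum coeff_monom using assms(1) by (simp add: sum.inter_filter)
  moreover have "coeff Q k = (\<Sum>y | y \<in> J \<and> b y = k. g y)"
    unfolding Q_def coeff_sum coeff_monom using assms(2) by (simp add: sum.inter_filter)
  ultimately show ?thesis by simp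
qed

lemma prob_embed_pmf_finite:
  fixes f :: "'a \<Rightarrow> real"
  assumes fin: "finite S" and supp: "\<And>x. x \<notin> S \<Longrightarrow> f x = 0"
    and nonneg: "\<And>x. 0 \<le> f x" and total: "(\<Sum>x\<in>S. f x) = 1"
  shows "measure_pmf.prob (embed_pmf f) A = (\<Sum>x\<in>S \<inter> A. f x)"
proof -
  have "(\<integral>\<^sup>+x. ennreal (f x) \<partial>count_space UNIV) = (\<Sum>x\<in>S. ennreal (f x))"
    using fin supp by (intro nn_integral_count_space') auto
  also have "\<dots> = 1" using nonneg total by (simp add: sum_ennreal)
  finally have pmf: "pmf (embed_pmf f) x = f x" for x
    using nonneg by (intro pmf_embed_pmf) auto
  have "set_pmf (embed_pmf f) \<subseteq> S" using supp pmf by (auto simp: set_pmf_eq)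
  then have "measure_pmf.prob (embed_pmf f) A = measure_pmf.prob (embed_pmf f) (S \<inter> A)"
    by (intro measure_pmf.finite_measure_eq_AE) (auto simp: AE_measure_pmf_iff)
  also have "\<dots> = (\<Sum>x\<in>S \<inter> A. pmf (embed_pmf f) x)"
    using fin by (intro measure_measure_pmf_finite) auto
  finally show ?thesis by (simp add: pmf)
qed

lemma set_det_mult:
  fixes n :: nat
  shows "set_det {..<n} (\<lambda>i j. \<Sum>k<n. F i k * G k j) = set_det {..<n} F * set_det {..<n} G"
proof -
  let ?F = "mat n n (\<lambda>(i, j). F i j)" and ?G = "mat n n (\<lambda>(i, j). G i j)"
  have "?F * ?G = mat n n (\<lambda>(i, j). \<Sum>k<n. F i k * G k j)"
    by (rule eq_matI) (auto simp: scalar_prod_def atLeast0LessThan)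
  then show ?thesis using det_mult[of ?F n ?G] by (simp add: det_mat_eq_set_det)
qed

lemma set_det_identity: "set_det {..<n::nat} (\<lambda>i j. if i = j then 1 else 0) = 1"
  using det_one[of n, where 'a = real] unfolding one_mat_def det_mat_eq_set_det .

section \<open>Both processes as mixtures over sets of eigenvectors\<close>

text \<open>\<open>u i l\<close> is entry \<open>i\<close> of the eigenvector for
  \<open>lam l\<close>; \<open>cols\<close> and \<open>rows\<close> express that these entries form
  an orthogonal matrix.\<close>

locale eigen_ensemble =
  fixes n :: nat and L :: "real mat" and u :: "nat \<Rightarrow> nat \<Rightarrow> real" and lam :: "nat \<Rightarrow> real"
  assumes L_carrier: "L \<in> carrier_mat n n"
    and L_eq: "\<And>i j. i < n \<Longrightarrow> j < n \<Longrightarrow> L $$ (i, j) = (\<Sum>l<n. lam l * u i l * u j l)"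
    and cols: "\<And>i j. i < n \<Longrightarrow> j < n \<Longrightarrow> (\<Sum>l<n. u l i * u l j) = (if i = j then 1 else 0)"
    and rows: "\<And>i j. i < n \<Longrightarrow> j < n \<Longrightarrow> (\<Sum>l<n. u i l * u j l) = (if i = j then 1 else 0)"
    and lam_pos: "\<And>l. l < n \<Longrightarrow> 0 < lam l"
begin

text \<open>For sets of equal size, the probability that the projection process spanned by the
  eigenvectors in \<open>\<beta>\<close> equals \<open>\<alpha>\<close>. The minor is transposed to
  match \<open>cauchy_binet_gram\<close>.\<close>

definition wt :: "nat set \<Rightarrow> nat set \<Rightarrow> real" where
  "wt \<alpha> \<beta> = (set_det {..<card \<alpha>} (\<lambda>i i'. u (pick \<alpha> i') (pick \<beta> i)))\<^sup>2"

lemma wt_nonneg: "0 \<le> wt \<alpha> \<beta>"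
  by (simp add: wt_def)

lemma set_det_spectral:
  assumes "\<alpha> \<subseteq> {..<n}"
  shows "set_det \<alpha> (\<lambda>i j. \<Sum>l<n. p l * u i l * u j l) =
    (\<Sum>\<beta> | \<beta> \<subseteq> {..<n} \<and> card \<beta> = card \<alpha>. (\<Prod>l\<in>\<beta>. p l) * wt \<alpha> \<beta>)"
proof -
  have fin: "finite \<alpha>" using assms finite_subset by blast
  show ?thesis
    unfolding wt_def set_det_reindex[OF bij_betw_pick[OF fin], symmetric, OF finite_lessThan]
    by (rule cauchy_binet_gram) simp
qed

text \<open>Cauchy-Binet with the roles of rows and columns exchanged: the columns in
  \<open>\<beta>\<close> are orthonormal, so their Gram determinant is 1 and expands into these
  weights.\<close>

lemma sum_wt:
  assumes \<beta>: "\<beta> \<subseteq> {..<n}"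
  shows "(\<Sum>\<alpha> | \<alpha> \<subseteq> {..<n} \<and> card \<alpha> = card \<beta>. wt \<alpha> \<beta>) = 1"
proof -
  let ?m = "card \<beta>"
  have fin: "finite \<beta>" using \<beta> finite_subset by blast
  note pick = bij_betw_pick[OF fin]
  have wt_transpose: "wt \<alpha> \<beta> = (set_det {..<?m} (\<lambda>i i'. u (pick \<alpha> i) (pick \<beta> i')))\<^sup>2"
    if "card \<alpha> = ?m" for \<alpha>
    using set_det_transpose[of "{..<?m}" "\<lambda>i i'. u (pick \<alpha> i) (pick \<beta> i')"] that
    by (simp add: wt_def)
  have "(\<Sum>\<alpha> | \<alpha> \<subseteq> {..<n} \<and> card \<alpha> = ?m. wt \<alpha> \<beta>) =
      (\<Sum>\<alpha> | \<alpha> \<subseteq> {..<n} \<and> card \<alpha> = ?m. (\<Prod>j\<in>\<alpha>. 1) *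
        (set_det {..<?m} (\<lambda>i i'. u (pick \<alpha> i) (pick \<beta> i')))\<^sup>2)"
    by (intro sum.cong refl) (auto simp: wt_transpose)
  also have "\<dots> = set_det {..<?m} (\<lambda>i i'. \<Sum>l<n. 1 * u l (pick \<beta> i) * u l (pick \<beta> i'))"
    by (rule cauchy_binet_gram[symmetric]) simp
  also have "\<dots> = set_det {..<?m} (\<lambda>i i'. if i = i' then 1 else 0)"
  proof (rule set_det_cong)
    fix i j assume ij: "i \<in> {..<?m}" "j \<in> {..<?m}"
    then have "pick \<beta> i < n" "pick \<beta> j < n" using pick \<beta> by (auto simp: bij_betw_def)
    moreover have "pick \<beta> i = pick \<beta> j \<longleftrightarrow> i = j"
      using pick ij by (auto simp: bij_betw_def inj_on_def)
    ultimately show "(\<Sum>l<n. 1 * u l (pick \<beta> i) * u l (pick \<beta> j)) = (if i = j then 1 else 0)"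
      by (simp add: cols)
  qed
  finally show ?thesis by (simp add: set_det_identity)
qed

lemma set_det_spectral_full: "set_det {..<n} (\<lambda>i j. \<Sum>l<n. p l * u i l * u j l) = (\<Prod>l<n. p l)"
proof -
  have "{\<beta>. \<beta> \<subseteq> {..<n} \<and> card \<beta> = n} = {{..<n}}"
    using card_subset_eq[of "{..<n}"] by auto
  then show ?thesis using set_det_spectral[of "{..<n}" p] sum_wt[of "{..<n}"] by simp
qed

abbreviation "Lf \<equiv> \<lambda>i j. L $$ (i, j)"

text \<open>
  The left-hand side is \<open>det (z L + I - I\<^sub>\<alpha>)\<close>, where \<open>I\<^sub>\<alpha>\<close> is the diagonal matrix of the indicator
  of \<open>\<alpha>\<close>. This matrix factors as \<open>(I + z L) G\<close>, where the columns of \<open>G\<close> in \<open>\<alpha>\<close> are those of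
  \<open>z L (I + z L)\<^sup>-\<^sup>1\<close> and the others are unit vectors.
\<close>

lemma minors_containing_generating:
  assumes z: "0 < z" and \<alpha>: "\<alpha> \<subseteq> {..<n}"
  shows "(\<Sum>X | \<alpha> \<subseteq> X \<and> X \<subseteq> {..<n}. z ^ card X * set_det X Lf) =
    (\<Prod>l<n. 1 + z * lam l) *
    (\<Sum>\<beta> | \<beta> \<subseteq> {..<n} \<and> card \<beta> = card \<alpha>. (\<Prod>l\<in>\<beta>. z * lam l / (1 + z * lam l)) * wt \<alpha> \<beta>)"
proof -
  define p where "p = (\<lambda>l. z * lam l / (1 + z * lam l))"
  define F where "F = (\<lambda>i j. \<Sum>l<n. (1 + z * lam l) * u i l * u j l)"
  define K where "K = (\<lambda>i j. \<Sum>l<n. p l * u i l * u j l)"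
  define G where "G = (\<lambda>i j. if j \<in> \<alpha> then K i j else if i = j then 1 else 0)"
  have F: "F i j = (if i = j then 1 else 0) + z * L $$ (i, j)" if "i < n" "j < n" for i j
  proof -
    have "F i j = (\<Sum>l<n. u i l * u j l + z * (lam l * u i l * u j l))"
      by (simp add: F_def algebra_simps)
    then show ?thesis by (simp add: sum.distrib rows[OF that] L_eq[OF that] flip: sum_distrib_left)
  qed
  \<comment> \<open>\<open>F\<close> is \<open>I + z L\<close> and \<open>K\<close> is
    \<open>z L (I + z L)^-1\<close>, both diagonal in the eigenbasis. Orthonormal columns collapse
    the double sum over \<open>l\<close> and \<open>l'\<close>, and the eigenvalues multiply to
    \<open>z * lam l\<close>.\<close>
  have FK: "(\<Sum>k<n. F i k * K k j) = z * L $$ (i, j)" if ij: "i < n" "j < n" for i j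
  proof -
    have "(\<Sum>k<n. F i k * K k j) =
        (\<Sum>k<n. \<Sum>l<n. \<Sum>l'<n. ((1 + z * lam l) * u i l * p l' * u j l') * (u k l * u k l'))"
      unfolding F_def K_def sum_product by (simp add: mult_ac)
    also have "\<dots> = (\<Sum>l<n. \<Sum>k<n. \<Sum>l'<n. ((1 + z * lam l) * u i l * p l' * u j l') * (u k l * u k l'))"
      by (rule sum.swap)
    also have "\<dots> = (\<Sum>l<n. \<Sum>l'<n. \<Sum>k<n. ((1 + z * lam l) * u i l * p l' * u j l') * (u k l * u k l'))"
      by (intro sum.cong refl sum.swap)
    also have "\<dots> = (\<Sum>l<n. \<Sum>l'<n. if l = l' then (1 + z * lam l) * u i l * p l' * u j l' else 0)"
      by (intro sum.cong refl) (simp add: sum_distrib_left[symmetric] cols)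
    also have "\<dots> = (\<Sum>l<n. (1 + z * lam l) * u i l * p l * u j l)"
      by simp
    also have "\<dots> = (\<Sum>l<n. z * (lam l * u i l * u j l))"
    proof (rule sum.cong[OF refl])
      fix l assume "l \<in> {..<n}"
      then have "0 < 1 + z * lam l" using lam_pos[of l] z by (simp add: add_pos_pos)
      then have "(1 + z * lam l) * p l = z * lam l" by (simp add: p_def)
      then show "(1 + z * lam l) * u i l * p l * u j l = z * (lam l * u i l * u j l)"
        by (metis (no_types, lifting) mult.assoc mult.commute)
    qed
    finally show ?thesis by (simp add: L_eq[OF ij] sum_distrib_left)
  qed
  have "(\<Sum>X | \<alpha> \<subseteq> X \<and> X \<subseteq> {..<n}. z ^ card X * set_det X Lf) =
      set_det {..<n} (\<lambda>i j. z * L $$ (i, j) + (if i \<notin> \<alpha> \<and> i = j then 1 else 0))"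
    by (rule set_det_add_diagonal[symmetric]) (use \<alpha> in auto)
  \<comment> \<open>Column by column: inside \<open>\<alpha>\<close> this is \<open>FK\<close>;
    elsewhere a unit column of \<open>G\<close> copies the column of \<open>F\<close>, which brings
    in the diagonal 1.\<close>
  also have "\<dots> = set_det {..<n} (\<lambda>i j. \<Sum>k<n. F i k * G k j)"
  proof (rule set_det_cong)
    fix i j assume ij: "i \<in> {..<n}" "j \<in> {..<n}"
    show "z * L $$ (i, j) + (if i \<notin> \<alpha> \<and> i = j then 1 else 0) = (\<Sum>k<n. F i k * G k j)"
    proof (cases "j \<in> \<alpha>")
      case True
      then show ?thesis using ij FK[of i j] by (auto simp: G_def)
    next
      case False
      then have "(\<Sum>k<n. F i k * G k j) = (\<Sum>k<n. if k = j then F i j else 0)"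
        by (intro sum.cong) (auto simp: G_def)
      then show ?thesis using ij F[of i j] False by auto
    qed
  qed
  also have "\<dots> = set_det {..<n} F * set_det {..<n} G" by (rule set_det_mult)
  also have "set_det {..<n} F = (\<Prod>l<n. 1 + z * lam l)"
    unfolding F_def by (rule set_det_spectral_full)
  also have "set_det {..<n} G = set_det \<alpha> K"
    unfolding G_def by (rule set_det_unit_columns) (use \<alpha> in auto)
  also have "\<dots> = (\<Sum>\<beta> | \<beta> \<subseteq> {..<n} \<and> card \<beta> = card \<alpha>. (\<Prod>l\<in>\<beta>. p l) * wt \<alpha> \<beta>)"
    unfolding K_def by (rule set_det_spectral[OF \<alpha>])
  finally show ?thesis unfolding p_def .
qed

lemma subsets_of_card_0: "{\<beta>. \<beta> \<subseteq> {..<n} \<and> card \<beta> = 0} = {{}}"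
  by (auto dest: finite_subset[OF _ finite_lessThan])

lemma wt_empty: "wt {} {} = 1"
  by (simp add: wt_def set_det_def)

lemma set_det_Lf_nonneg:
  assumes "X \<subseteq> {..<n}"
  shows "0 \<le> set_det X Lf"
proof -
  have "set_det X Lf = set_det X (\<lambda>i j. \<Sum>l<n. lam l * u i l * u j l)"
    using assms by (intro set_det_cong L_eq) auto
  also have "\<dots> = (\<Sum>\<beta> | \<beta> \<subseteq> {..<n} \<and> card \<beta> = card X. (\<Prod>l\<in>\<beta>. lam l) * wt X \<beta>)"
    by (rule set_det_spectral[OF assms])
  also have "\<dots> \<ge> 0"
    using lam_pos by (intro sum_nonneg mult_nonneg_nonneg wt_nonneg prod_nonneg) (auto intro!: less_imp_le)
  finally show ?thesis .
qed

text \<open>Compare the coefficients of \<open>t ^ k\<close> in the generating identity. For fixed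
  \<open>\<beta>\<close> the dependence on \<open>t\<close> is the generating function of the sets
  \<open>Y\<close> containing \<open>\<beta>\<close>, and \<open>esym_containing\<close> sums those
  of size \<open>k\<close>.\<close>

lemma minors_containing_card:
  assumes \<alpha>: "\<alpha> \<subseteq> {..<n}"
  shows "(\<Sum>X | \<alpha> \<subseteq> X \<and> X \<subseteq> {..<n} \<and> card X = k. set_det X Lf) =
    (\<Sum>\<beta> | \<beta> \<subseteq> {..<n} \<and> card \<beta> = card \<alpha>.
      (\<Prod>l\<in>\<beta>. lam l) * esym lam ({..<n} - \<beta>) (int k - int (card \<beta>)) * wt \<alpha> \<beta>)"
proof -
  let ?N = "{..<n}"
  let ?I = "{X. \<alpha> \<subseteq> X \<and> X \<subseteq> ?N}"
  let ?B = "{\<beta>. \<beta> \<subseteq> ?N \<and> card \<beta> = card \<alpha>}"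
  let ?S = "\<lambda>\<beta>. {Y. \<beta> \<subseteq> Y \<and> Y \<subseteq> ?N}"
  have fin: "finite ?I" "finite ?B" "finite (?S \<beta>)" for \<beta>
    by (auto intro: finite_subset[of _ "Pow ?N"])
  \<comment> \<open>Factors with \<open>l \<in> \<beta>\<close> become \<open>t * lam l\<close>, the
    others stay \<open>1 + t * lam l\<close>; the expanded product keeps only sets containing
    \<open>\<beta>\<close>.\<close>
  have expand: "(\<Prod>l<n. 1 + t * lam l) * (\<Prod>l\<in>\<beta>. t * lam l / (1 + t * lam l)) =
      (\<Sum>Y\<in>?S \<beta>. t ^ card Y * (\<Prod>l\<in>Y. lam l))" if t: "0 < t" and \<beta>: "\<beta> \<subseteq> ?N" for t \<beta>
  proof -
    have "(\<Prod>l<n. 1 + t * lam l) * (\<Prod>l\<in>\<beta>. t * lam l / (1 + t * lam l)) =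
        (\<Prod>l<n. 1 + t * lam l) * (\<Prod>l<n. if l \<in> \<beta> then t * lam l / (1 + t * lam l) else 1)"
      using \<beta> by (simp add: prod.If_cases Int_absorb1)
    also have "\<dots> = (\<Prod>l<n. t * lam l + (if l \<in> \<beta> then 0 else 1))"
      unfolding prod.distrib[symmetric]
    proof (rule prod.cong[OF refl])
      fix l assume "l \<in> ?N"
      then have "0 < 1 + t * lam l" using lam_pos[of l] t by (simp add: add_pos_pos)
      then show "(1 + t * lam l) * (if l \<in> \<beta> then t * lam l / (1 + t * lam l) else 1) =
          t * lam l + (if l \<in> \<beta> then 0 else 1)" by simp
    qed
    also have "\<dots> = (\<Sum>Y\<in>Pow ?N. (\<Prod>l\<in>Y. t * lam l) * (\<Prod>l\<in>?N - Y. if l \<in> \<beta> then 0 else 1))"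
      by (rule prod_add) simp
    also have "\<dots> = (\<Sum>Y\<in>?S \<beta>. t ^ card Y * (\<Prod>l\<in>Y. lam l))"
    proof (rule sum.mono_neutral_cong_right)
      show "\<forall>Y\<in>Pow ?N - ?S \<beta>. (\<Prod>l\<in>Y. t * lam l) * (\<Prod>l\<in>?N - Y. if l \<in> \<beta> then 0 else 1) = 0"
      proof
        fix Y assume "Y \<in> Pow ?N - ?S \<beta>"
        then obtain l where "l \<in> ?N - Y" "l \<in> \<beta>" using \<beta> by auto
        then have "(\<Prod>l\<in>?N - Y. if l \<in> \<beta> then 0 else 1) = (0::real)"
          by (intro prod_zero bexI[of _ l]) auto
        then show "(\<Prod>l\<in>Y. t * lam l) * (\<Prod>l\<in>?N - Y. if l \<in> \<beta> then 0 else 1) = 0" by simp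
      qed
      fix Y assume "Y \<in> ?S \<beta>"
      then have "(\<Prod>l\<in>?N - Y. if l \<in> \<beta> then 0 else 1) = (1::real)" by (intro prod.neutral) auto
      then show "(\<Prod>l\<in>Y. t * lam l) * (\<Prod>l\<in>?N - Y. if l \<in> \<beta> then 0 else 1) =
          t ^ card Y * (\<Prod>l\<in>Y. lam l)" by (simp add: prod.distrib)
    qed auto
    finally show ?thesis .
  qed
  have "(\<Sum>X | X \<in> ?I \<and> card X = k. set_det X Lf) =
      (\<Sum>y | y \<in> Sigma ?B ?S \<and> card (snd y) = k. (\<Prod>l\<in>snd y. lam l) * wt \<alpha> (fst y))"
  proof (rule sum_coeff_eq)
    fix t :: real assume t: "0 < t"
    have "(\<Sum>X\<in>?I. t ^ card X * set_det X Lf) =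
        (\<Sum>\<beta>\<in>?B. ((\<Prod>l<n. 1 + t * lam l) * (\<Prod>l\<in>\<beta>. t * lam l / (1 + t * lam l))) * wt \<alpha> \<beta>)"
      unfolding minors_containing_generating[OF t \<alpha>] by (simp add: sum_distrib_left mult.assoc)
    also have "\<dots> = (\<Sum>\<beta>\<in>?B. \<Sum>Y\<in>?S \<beta>. t ^ card Y * ((\<Prod>l\<in>Y. lam l) * wt \<alpha> \<beta>))"
      by (intro sum.cong refl, subst expand[OF t]) (auto simp: sum_distrib_right mult.assoc)
    also have "\<dots> = (\<Sum>(\<beta>, Y)\<in>Sigma ?B ?S. t ^ card Y * ((\<Prod>l\<in>Y. lam l) * wt \<alpha> \<beta>))"
      using fin by (intro sum.Sigma) auto
    finally show "(\<Sum>X\<in>?I. t ^ card X * set_det X Lf) =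
        (\<Sum>y\<in>Sigma ?B ?S. t ^ card (snd y) * ((\<Prod>l\<in>snd y. lam l) * wt \<alpha> (fst y)))"
      by (simp add: split_def)
  qed (use fin in auto)
  also have "{y. y \<in> Sigma ?B ?S \<and> card (snd y) = k} =
      Sigma ?B (\<lambda>\<beta>. {Y. \<beta> \<subseteq> Y \<and> Y \<subseteq> ?N \<and> int (card Y) = int k})"
    by auto
  also have "(\<Sum>y\<in>\<dots>. (\<Prod>l\<in>snd y. lam l) * wt \<alpha> (fst y)) =
      (\<Sum>\<beta>\<in>?B. \<Sum>Y | \<beta> \<subseteq> Y \<and> Y \<subseteq> ?N \<and> int (card Y) = int k. (\<Prod>l\<in>Y. lam l) * wt \<alpha> \<beta>)"
    using fin by (subst sum.Sigma) (auto simp: split_def intro: finite_subset[of _ "Pow ?N"])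
  also have "\<dots> = (\<Sum>\<beta>\<in>?B. (\<Prod>l\<in>\<beta>. lam l) * esym lam (?N - \<beta>) (int k - int (card \<beta>)) * wt \<alpha> \<beta>)"
    unfolding sum_distrib_right[symmetric]
    by (intro sum.cong refl arg_cong2[of _ _ _ _ "(*)"] esym_containing) auto
  finally show ?thesis by (simp add: conj_assoc)
qed

lemma principal_minor_smult:
  assumes "X \<subseteq> {..<n}"
  shows "principal_minor (z \<cdot>\<^sub>m L) X = z ^ card X * set_det X Lf"
proof -
  have "principal_minor (z \<cdot>\<^sub>m L) X = set_det X (\<lambda>i j. (z \<cdot>\<^sub>m L) $$ (i, j))"
    using L_carrier assms by (intro principal_minor_eq_set_det) auto
  also have "\<dots> = set_det X (\<lambda>i j. z * L $$ (i, j))"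
  proof (rule set_det_cong)
    fix i j assume "i \<in> X" "j \<in> X"
    then have "i < n" "j < n" using assms by auto
    then show "(z \<cdot>\<^sub>m L) $$ (i, j) = z * L $$ (i, j)" using L_carrier by simp
  qed
  also have "\<dots> = z ^ card X * set_det X Lf"
    by (simp add: set_det_def prod.distrib sum_distrib_left mult_ac)
  finally show ?thesis .
qed

text \<open>The generating identity gives the numerator at \<open>\<alpha>\<close> and the
  normaliser \<open>Z\<close> at the empty set, and \<open>Z\<close> cancels. What remains is the
  mixture with independent choices of odds \<open>z * lam l\<close>.\<close>

lemma inclusion_prob_dpp:
  assumes z: "0 < z" and \<alpha>: "\<alpha> \<subseteq> {..<n}"
  shows "inclusion_prob (dpp (z \<cdot>\<^sub>m L)) \<alpha> =
    (\<Sum>\<beta> | \<beta> \<subseteq> {..<n} \<and> card \<beta> = card \<alpha>. (\<Prod>l\<in>\<beta>. z * lam l / (1 + z * lam l)) * wt \<alpha> \<beta>)"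
proof -
  let ?N = "{..<n}"
  define Z where "Z = (\<Prod>l<n. 1 + z * lam l)"
  define f where "f = (\<lambda>X. if X \<subseteq> ?N then z ^ card X * set_det X Lf / Z else 0)"
  have Z: "0 < Z" unfolding Z_def using lam_pos z by (intro prod_pos) (auto intro!: add_pos_pos)
  have total: "(\<Sum>X\<in>Pow ?N. z ^ card X * set_det X Lf) = Z"
    using minors_containing_generating[OF z, of "{}"]
    by (simp add: Z_def subsets_of_card_0 wt_empty Pow_def)
  have "1\<^sub>m n + z \<cdot>\<^sub>m L = mat n n (\<lambda>(i, j). z * L $$ (i, j) + (if i \<notin> {} \<and> i = j then 1 else 0))"
    using L_carrier by (intro eq_matI) auto
  then have "Determinant.det (1\<^sub>m n + z \<cdot>\<^sub>m L) = Z"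
    using total by (simp add: det_mat_eq_set_det set_det_add_diagonal[of _ "{}", simplified] Pow_def)
  then have dpp: "dpp (z \<cdot>\<^sub>m L) = embed_pmf f"
    unfolding dpp_def f_def using L_carrier
    by (intro arg_cong[of _ _ embed_pmf] ext) (auto simp: principal_minor_smult)
  have "inclusion_prob (dpp (z \<cdot>\<^sub>m L)) \<alpha> = (\<Sum>X\<in>Pow ?N \<inter> {X. \<alpha> \<subseteq> X}. f X)"
    unfolding inclusion_prob_def dpp
  proof (rule prob_embed_pmf_finite)
    show "0 \<le> f X" for X using Z z set_det_Lf_nonneg by (auto simp: f_def)
    have "(\<Sum>X\<in>Pow ?N. f X) = (\<Sum>X\<in>Pow ?N. z ^ card X * set_det X Lf) / Z"
      unfolding sum_divide_distrib by (intro sum.cong) (auto simp: f_def)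
    then show "(\<Sum>X\<in>Pow ?N. f X) = 1" using Z total by simp
  qed (auto simp: f_def)
  also have "\<dots> = (\<Sum>X | \<alpha> \<subseteq> X \<and> X \<subseteq> ?N. z ^ card X * set_det X Lf) / Z"
    unfolding sum_divide_distrib by (intro sum.cong) (auto simp: f_def)
  finally show ?thesis
    unfolding minors_containing_generating[OF z \<alpha>] Z_def[symmetric] using Z by simp
qed

text \<open>The same at fixed size: the empty set gives the elementary symmetric function of degree
  \<open>k\<close> as normaliser, and the quotient is \<open>cond_incl\<close>.\<close>

lemma inclusion_prob_k_dpp:
  assumes k: "k \<le> n" and \<alpha>: "\<alpha> \<subseteq> {..<n}"
  shows "inclusion_prob (k_dpp k L) \<alpha> =
    (\<Sum>\<beta> | \<beta> \<subseteq> {..<n} \<and> card \<beta> = card \<alpha>. cond_incl lam {..<n} (int k) \<beta> * wt \<alpha> \<beta>)"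
proof -
  let ?N = "{..<n}"
  let ?S = "{X. X \<subseteq> ?N \<and> card X = k}"
  define E where "E = esym lam ?N (int k)"
  define f where "f = (\<lambda>X. if X \<subseteq> ?N \<and> card X = k then set_det X Lf / E else 0)"
  have E: "0 < E" unfolding E_def using k lam_pos by (intro esym_pos) auto
  have fin: "finite ?S" by (auto intro: finite_subset[of _ "Pow ?N"])
  have total: "(\<Sum>X\<in>?S. set_det X Lf) = E"
    using minors_containing_card[of "{}" k] by (simp add: subsets_of_card_0 wt_empty E_def)
  have minor: "principal_minor L X = set_det X Lf" if "X \<subseteq> ?N" for X
    by (rule principal_minor_eq_set_det[OF L_carrier that])
  have "(\<Sum>X\<in>?S. principal_minor L X) = E"
    unfolding total[symmetric] by (intro sum.cong refl minor) auto
  then have k_dpp: "k_dpp k L = embed_pmf f"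
    unfolding k_dpp_def f_def using L_carrier
    by (intro arg_cong[of _ _ embed_pmf] ext) (auto simp: minor)
  have "inclusion_prob (k_dpp k L) \<alpha> = (\<Sum>X\<in>?S \<inter> {X. \<alpha> \<subseteq> X}. f X)"
    unfolding inclusion_prob_def k_dpp
  proof (rule prob_embed_pmf_finite[OF fin])
    show "0 \<le> f X" for X using E set_det_Lf_nonneg by (auto simp: f_def)
    have "(\<Sum>X\<in>?S. f X) = (\<Sum>X\<in>?S. set_det X Lf) / E"
      unfolding sum_divide_distrib by (intro sum.cong) (auto simp: f_def)
    then show "(\<Sum>X\<in>?S. f X) = 1" using E total by simp
  qed (auto simp: f_def)
  also have "\<dots> = (\<Sum>X | \<alpha> \<subseteq> X \<and> X \<subseteq> ?N \<and> card X = k. set_det X Lf) / E"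
    unfolding sum_divide_distrib by (intro sum.cong) (auto simp: f_def)
  finally show ?thesis
    unfolding minors_containing_card[OF \<alpha>] by (simp add: cond_incl_def E_def sum_divide_distrib)
qed

text \<open>Numerator and denominator both scale by \<open>z ^ k\<close>. Hence the
  \<open>k\<close>-DPP can be described by the same odds \<open>z * lam l\<close> as the matched
  DPP, which makes the comparison of the two laws applicable.\<close>

lemma cond_incl_scale:
  assumes z: "0 < z" and \<beta>: "\<beta> \<subseteq> A" and fin: "finite A"
  shows "cond_incl (\<lambda>l. z * x l) A (int k) \<beta> = cond_incl x A (int k) \<beta>"
proof -
  have scale: "(\<Prod>j\<in>\<beta>. z * x j) * esym (\<lambda>l. z * x l) (A - \<beta>) (int k - int (card \<beta>)) =
      z ^ k * ((\<Prod>j\<in>\<beta>. x j) * esym x (A - \<beta>) (int k - int (card \<beta>)))" if "\<beta> \<subseteq> A" for \<beta>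
    unfolding esym_containing[OF fin that, symmetric] sum_distrib_left
    by (intro sum.cong) (auto simp: prod.distrib)
  show ?thesis
    unfolding cond_incl_def scale[OF \<beta>] using scale[of "{}"] z by simp
qed

text \<open>Both processes mix the same weights \<open>wt\<close>, so only the mixing coefficients
  differ. Summation over \<open>\<alpha>\<close> removes the weights by \<open>sum_wt\<close> and
  leaves the distance bounded in \<open>cond_incl_l1\<close>.\<close>

lemma incl_dist_k_dpp_dpp_le:
  assumes z: "0 < z" and k: "1 \<le> k" and m: "m \<le> k"
    and mean: "(\<Sum>l<n. lam l * z / (1 + lam l * z)) = real k"
  shows "incl_dist n k m (inclusion_prob (k_dpp k L)) (inclusion_prob (dpp (z \<cdot>\<^sub>m L)))
    \<le> real m * (real m + 4) * real k ^ (m - 1) / real (k choose m)"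
proof -
  let ?N = "{..<n}"
  let ?B = "{\<beta>. \<beta> \<subseteq> ?N \<and> card \<beta> = m}"
  define x where "x = (\<lambda>l. z * lam l)"
  define D where "D = (\<lambda>\<beta>. cond_incl x ?N (int k) \<beta> - (\<Prod>l\<in>\<beta>. x l / (1 + x l)))"
  have x: "0 < x l" if "l \<in> ?N" for l using that lam_pos z by (simp add: x_def)
  have mean': "(\<Sum>l\<in>?N. x l / (1 + x l)) = real_of_int (int k)"
    using mean by (simp add: x_def mult.commute)
  \<comment> \<open>The matching condition forces this, since every summand is below 1.\<close>
  have "real k < real n"
  proof -
    have "n \<noteq> 0" using mean k by (cases n) auto
    then have "(\<Sum>l\<in>?N. x l / (1 + x l)) < (\<Sum>l\<in>?N. 1)"
    proof (intro sum_strict_mono)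
      fix l assume "l \<in> ?N"
      from x[OF this] show "x l / (1 + x l) < 1" by simp
    qed auto
    then show ?thesis using mean' by simp
  qed
  then have kn: "k \<le> n" by simp
  have "\<bar>inclusion_prob (k_dpp k L) \<alpha> - inclusion_prob (dpp (z \<cdot>\<^sub>m L)) \<alpha>\<bar> \<le> (\<Sum>\<beta>\<in>?B. \<bar>D \<beta>\<bar> * wt \<alpha> \<beta>)"
    if \<alpha>: "\<alpha> \<in> ?B" for \<alpha>
  proof -
    have "inclusion_prob (k_dpp k L) \<alpha> - inclusion_prob (dpp (z \<cdot>\<^sub>m L)) \<alpha> = (\<Sum>\<beta>\<in>?B. D \<beta> * wt \<alpha> \<beta>)"
      using \<alpha> cond_incl_scale[OF z, of _ ?N lam k]
      by (simp add: inclusion_prob_k_dpp[OF kn] inclusion_prob_dpp[OF z] D_def x_def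
        left_diff_distrib sum_subtractf)
    also have "\<bar>\<dots>\<bar> \<le> (\<Sum>\<beta>\<in>?B. \<bar>D \<beta> * wt \<alpha> \<beta>\<bar>)" by (rule sum_abs)
    finally show ?thesis by (simp add: abs_mult wt_nonneg)
  qed
  then have "(\<Sum>\<alpha>\<in>?B. \<bar>inclusion_prob (k_dpp k L) \<alpha> - inclusion_prob (dpp (z \<cdot>\<^sub>m L)) \<alpha>\<bar>)
      \<le> (\<Sum>\<alpha>\<in>?B. \<Sum>\<beta>\<in>?B. \<bar>D \<beta>\<bar> * wt \<alpha> \<beta>)" by (rule sum_mono)
  also have "\<dots> = (\<Sum>\<beta>\<in>?B. \<bar>D \<beta>\<bar> * (\<Sum>\<alpha>\<in>?B. wt \<alpha> \<beta>))"
    unfolding sum_distrib_left by (rule sum.swap)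
  also have "\<dots> = (\<Sum>\<beta>\<in>?B. \<bar>D \<beta>\<bar>)"
    using sum_wt by (intro sum.cong refl) auto
  also have "\<dots> \<le> real m * (real m + 4) * real k ^ (m - 1)"
    using cond_incl_l1[of ?N x "int k" m] x k m mean' by (simp add: D_def)
  finally show ?thesis unfolding incl_dist_def by (intro divide_right_mono) auto
qed

end

section \<open>From positive definite matrices to the asymptotic bound\<close>

text \<open>The quadratic form at column \<open>l\<close> of \<open>U\<close> equals
  \<open>d l\<close>, so positive definiteness makes every eigenvalue positive.\<close>

lemma sym_pos_def_eigen_ensemble:
  assumes "sym_pos_def_mat n A"
  obtains u lam where "eigen_ensemble n A u lam" "eigvals A = mset (map lam [0..<n])"
proof -
  have A: "A \<in> carrier_mat n n" "transpose_mat A = A"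
    and pd: "\<And>v. v \<in> carrier_vec n \<Longrightarrow> v \<noteq> 0\<^sub>v n \<Longrightarrow> scalar_prod v (A *\<^sub>v v) > 0"
    using assms unfolding sym_pos_def_mat_def by blast+
  obtain U d where U: "U \<in> carrier_mat n n" "transpose_mat U * U = 1\<^sub>m n"
    "A = U * diagonal n d * transpose_mat U"
    using real_spectral_decomposition[OF A] by blast
  note coords = spectral_decomposition_coords[OF U]
  have "0 < d l" if l: "l < n" for l
  proof -
    define v where "v = col U l"
    have v: "v \<in> carrier_vec n" "\<And>i. i < n \<Longrightarrow> v $ i = U $$ (i, l)" using U l by (auto simp: v_def)
    have "v \<noteq> 0\<^sub>v n"
    proof
      assume "v = 0\<^sub>v n"
      then have "U $$ (i, l) = 0" if "i < n" for i using v(2)[OF that] that by simp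
      then show False using coords(2)[OF l l] by simp
    qed
    have Av: "(A *\<^sub>v v) $ i = d l * U $$ (i, l)" if i: "i < n" for i
    proof -
      have "(A *\<^sub>v v) $ i = (\<Sum>j<n. A $$ (i, j) * U $$ (j, l))"
        using A v i by (simp add: scalar_prod_def atLeast0LessThan)
      also have "\<dots> = (\<Sum>j<n. \<Sum>l'<n. (d l' * U $$ (i, l')) * (U $$ (j, l') * U $$ (j, l)))"
        using coords(1)[OF i] by (simp add: sum_distrib_right mult.assoc)
      also have "\<dots> = (\<Sum>l'<n. \<Sum>j<n. (d l' * U $$ (i, l')) * (U $$ (j, l') * U $$ (j, l)))"
        by (rule sum.swap)
      also have "\<dots> = (\<Sum>l'<n. if l' = l then d l' * U $$ (i, l') else 0)"
        by (intro sum.cong refl) (simp add: sum_distrib_left[symmetric] coords(2) l)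
      finally show ?thesis using l by simp
    qed
    have "scalar_prod v (A *\<^sub>v v) = (\<Sum>i<n. U $$ (i, l) * (d l * U $$ (i, l)))"
      using A v Av by (simp add: scalar_prod_def atLeast0LessThan)
    also have "\<dots> = d l * (\<Sum>i<n. U $$ (i, l) * U $$ (i, l))"
      by (simp add: sum_distrib_left mult_ac)
    finally have "scalar_prod v (A *\<^sub>v v) = d l" using coords(2)[OF l l] by simp
    then show ?thesis using pd[OF v(1) \<open>v \<noteq> 0\<^sub>v n\<close>] by simp
  qed
  then have "eigen_ensemble n A (\<lambda>i j. U $$ (i, j)) d"
    using coords by unfold_locales auto
  then show ?thesis using coords(4) by (rule that)
qed

theorem theorem2p1:
  fixes r :: real
    and k :: "nat \<Rightarrow> nat"
    and L :: "nat \<Rightarrow> real mat"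
    and \<nu> :: "nat \<Rightarrow> real"
    and m :: nat
  assumes r_pos: "r > 0"
    and k_def: "\<And>n. k n = nat \<lfloor>r * real n\<rfloor>"
    and pos_def: "\<And>n. n \<ge> 1 \<Longrightarrow> sym_pos_def_mat n (L n)"
    and trace_lim:
      "filterlim (\<lambda>n. mat_trace ((inv_mat (L n + 1\<^sub>m n) ^\<^sub>m 2) * L n)) at_top sequentially"
    and matched:
      "\<forall>\<^sub>F n in sequentially.
         (\<Sum>x\<in>#eigvals (L n). x * exp (\<nu> n) / (1 + x * exp (\<nu> n))) = real (k n)"
    and m_pos: "m \<ge> 1"
  shows "(\<lambda>n. incl_dist n (k n) m
               (inclusion_prob (k_dpp (k n) (L n)))
               (inclusion_prob (dpp (exp (\<nu> n) \<cdot>\<^sub>m L n))))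
           \<in> O(\<lambda>n. 1 / real n)"
proof (rule bigoI)
  \<comment> \<open>\<open>real m ^ m\<close> comes from
    \<open>k choose m \<ge> (k / m) ^ m\<close>, and \<open>2 / r\<close> from
    \<open>k \<ge> r * n / 2\<close>.\<close>
  define C where "C = real m * (real m + 4) * real m ^ m * (2 / r)"
  \<comment> \<open>Beyond this threshold \<open>r * n - 1\<close>, a lower bound for the floor
    \<open>k n\<close>, is at least both \<open>r * n / 2\<close> and \<open>m\<close>.\<close>
  have "\<forall>\<^sub>F n in sequentially. real n \<ge> 2 * (real m + 1) / r"
    using filterlim_real_sequentially unfolding filterlim_at_top by blast
  moreover have "\<forall>\<^sub>F n in sequentially. n \<ge> (1::nat)" by (rule eventually_ge_at_top)
  ultimately show "\<forall>\<^sub>F n in sequentially.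
      norm (incl_dist n (k n) m (inclusion_prob (k_dpp (k n) (L n)))
        (inclusion_prob (dpp (exp (\<nu> n) \<cdot>\<^sub>m L n)))) \<le> C * norm (1 / real n)"
    using matched
  proof eventually_elim
    case (elim n)
    have rn: "r * real n \<ge> 2 * (real m + 1)" using elim(1) r_pos by (simp add: field_simps)
    have "real (k n) \<ge> r * real n - 1"
      unfolding k_def using rn by linarith
    then have k_ge: "real (k n) \<ge> r * real n / 2" and "real m \<le> real (k n)" using rn by simp_all
    then have mk: "m \<le> k n" by simp
    have k1: "1 \<le> k n" using mk m_pos by simp
    obtain u lam where ens: "eigen_ensemble n (L n) u lam" and eig: "eigvals (L n) = mset (map lam [0..<n])"
      using sym_pos_def_eigen_ensemble[OF pos_def[OF elim(2)]] by blast
    have "(\<Sum>x\<in>#eigvals (L n). x * exp (\<nu> n) / (1 + x * exp (\<nu> n))) =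
        (\<Sum>l<n. lam l * exp (\<nu> n) / (1 + lam l * exp (\<nu> n)))"
      unfolding eig by (simp add: sum_unfold_sum_mset image_mset.compositionality o_def atLeast0LessThan)
    then have mean: "(\<Sum>l<n. lam l * exp (\<nu> n) / (1 + lam l * exp (\<nu> n))) = real (k n)"
      using elim(3) by simp
    have "incl_dist n (k n) m (inclusion_prob (k_dpp (k n) (L n)))
        (inclusion_prob (dpp (exp (\<nu> n) \<cdot>\<^sub>m L n)))
        \<le> real m * (real m + 4) * real (k n) ^ (m - 1) / real (k n choose m)"
      by (rule eigen_ensemble.incl_dist_k_dpp_dpp_le[OF ens _ k1 mk mean]) simp
    also have "\<dots> \<le> real m * (real m + 4) * real (k n) ^ (m - 1) / (real (k n) / real m) ^ m"
      using binomial_ge_n_over_k_pow_k[OF mk, where 'a = real] k1 m_pos mk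
      by (intro divide_left_mono mult_nonneg_nonneg mult_pos_pos) auto
    \<comment> \<open>Since \<open>m \<ge> 1\<close>, the powers \<open>k ^ (m - 1)\<close> and
      \<open>k ^ m\<close> leave a single factor \<open>k\<close> below, which is the rate.\<close>
    also have "\<dots> = real m * (real m + 4) * real m ^ m / real (k n)"
      using k1 m_pos by (cases m) (auto simp: power_divide field_simps)
    also have "\<dots> \<le> real m * (real m + 4) * real m ^ m / (r * real n / 2)"
      using k_ge k1 r_pos elim(2) by (intro divide_left_mono mult_nonneg_nonneg mult_pos_pos) auto
    also have "\<dots> = C * norm (1 / real n)" by (simp add: C_def)
    finally show ?case by (simp add: incl_dist_def sum_nonneg)
  qed
qed

end
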